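(* Let $F$ be a free group of finite rank. The properties (of subgroups of $F$) of being inert and of being compressed are closed under free factors: every free factor of an inert (resp. compressed) subgroup of $F$ is inert (resp. compressed). In addition, inertness is closed under intersections: the intersection of any family of inert subgroups of $F$ is inert. Each subgroup $H\le F$ admits an inert closure (a least inert subgroup of $F$ containing $H$), which is an algebraic extension of $H$.
   Context: Write $\mathrm{rk}$ for the rank of a free group. A subgroup $H\le F$ is compressed if $\mathrm{rk}(H)\le\mathrm{rk}(K)$ for every $K\le F$ containing $H$; it is inert if $\mathrm{rk}(H\cap K)\le\mathrm{rk}(K)$ for every $K\le F$. A subgroup $L$ of $K$ is a free factor of $K$ if $K=L*M$ for some $M\le K$. For free groups $H\le K$, $K$ is an algebraic extension of $H$ if every $x\in K$ lies in every free factor of $K$ containing $H$. *)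

theory Defs
  imports "HOL-Algebra.Algebra"
begin

unbundle cardinal_syntax

text \<open>
  A letter \<open>(True, x)\<close> stands for \<open>x\<close>, a letter \<open>(False, x)\<close> for the inverse of \<open>x\<close>.
  The reduced words over \<open>B\<close> are the elements of the free group on \<open>B\<close>.
\<close>

definition reduced_words :: "'a set \<Rightarrow> (bool \<times> 'a) list set" where
  "reduced_words B =
     {w. set w \<subseteq> UNIV \<times> B \<and> successively (\<lambda>u v. \<not> (snd u = snd v \<and> fst u \<noteq> fst v)) w}"

definition letter_val :: "('a, 'b) monoid_scheme \<Rightarrow> bool \<times> 'a \<Rightarrow> 'a" where
  "letter_val G u = (if fst u then snd u else inv\<^bsub>G\<^esub> (snd u))"

definition list_mult :: "('a, 'b) monoid_scheme \<Rightarrow> 'a list \<Rightarrow> 'a" where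
  "list_mult G xs = foldr (\<lambda>x y. x \<otimes>\<^bsub>G\<^esub> y) xs \<one>\<^bsub>G\<^esub>"

text \<open>
  \<open>B\<close> is a basis of \<open>G\<close> if the canonical map from the free group on \<open>B\<close> to \<open>G\<close> is bijective.
\<close>

definition free_basis :: "('a, 'b) monoid_scheme \<Rightarrow> 'a set \<Rightarrow> bool" where
  "free_basis G B \<longleftrightarrow>
     B \<subseteq> carrier G \<and>
     bij_betw (\<lambda>w. list_mult G (map (letter_val G) w)) (reduced_words B) (carrier G)"

text \<open>
  The rank is a cardinal, so infinite ranks are covered; ranks are to be compared with \<open>\<le>o\<close>.
  It is meaningful only for free groups.
\<close>

definition rk :: "('a, 'b) monoid_scheme \<Rightarrow> 'a rel" where
  "rk G = |SOME B. free_basis G B|"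

text \<open>
  The elements of the abstract free product of \<open>L\<close> and \<open>M\<close> are the sequences of nontrivial
  elements taken alternately from \<open>L\<close> and \<open>M\<close>.  The tags \<open>Inl\<close> and \<open>Inr\<close> are essential: they keep
  the two factors disjoint even if the subgroups \<open>L\<close> and \<open>M\<close> intersect nontrivially.
\<close>

definition alternating_words :: "('a, 'b) monoid_scheme \<Rightarrow> 'a set \<Rightarrow> 'a set \<Rightarrow> ('a + 'a) list set" where
  "alternating_words G L M =
     {w. set w \<subseteq> Inl ` (L - {\<one>\<^bsub>G\<^esub>}) \<union> Inr ` (M - {\<one>\<^bsub>G\<^esub>}) \<and> successively (\<lambda>u v. isl u \<noteq> isl v) w}"

text \<open>
  \<open>G = L * M\<close>: the canonical map from the abstract free product to \<open>G\<close> is bijective.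
\<close>

definition is_free_product :: "('a, 'b) monoid_scheme \<Rightarrow> 'a set \<Rightarrow> 'a set \<Rightarrow> bool" where
  "is_free_product G L M \<longleftrightarrow>
     subgroup L G \<and> subgroup M G \<and>
     bij_betw (\<lambda>w. list_mult G (map (case_sum id id) w)) (alternating_words G L M) (carrier G)"

definition free_factor :: "'a set \<Rightarrow> ('a, 'b) monoid_scheme \<Rightarrow> bool" where
  "free_factor L G \<longleftrightarrow> (\<exists>M. is_free_product G L M)"

definition algebraic_extension :: "'a set \<Rightarrow> ('a, 'b) monoid_scheme \<Rightarrow> bool" where
  "algebraic_extension H G \<longleftrightarrow>
     subgroup H G \<and> (\<forall>x\<in>carrier G. \<forall>L. free_factor L G \<and> H \<subseteq> L \<longrightarrow> x \<in> L)"

definition compressed :: "('a, 'b) monoid_scheme \<Rightarrow> 'a set \<Rightarrow> bool" where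
  "compressed F H \<longleftrightarrow>
     subgroup H F \<and>
     (\<forall>K. subgroup K F \<and> H \<subseteq> K \<longrightarrow> rk (F\<lparr>carrier := H\<rparr>) \<le>o rk (F\<lparr>carrier := K\<rparr>))"

definition inert :: "('a, 'b) monoid_scheme \<Rightarrow> 'a set \<Rightarrow> bool" where
  "inert F H \<longleftrightarrow>
     subgroup H F \<and>
     (\<forall>K. subgroup K F \<longrightarrow> rk (F\<lparr>carrier := H \<inter> K\<rparr>) \<le>o rk (F\<lparr>carrier := K\<rparr>))"

definition inert_closure :: "('a, 'b) monoid_scheme \<Rightarrow> 'a set \<Rightarrow> 'a set \<Rightarrow> bool" where
  "inert_closure F H C \<longleftrightarrow>
     inert F C \<and> H \<subseteq> C \<and> (\<forall>K. inert F K \<and> H \<subseteq> K \<longrightarrow> C \<subseteq> K)"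

end

theory Submission
  imports Defs "HOL-Library.Countable_Set"
begin

text \<open>
  Ranks of free groups are compared by counting homomorphisms to the group of order two: if \<open>U\<close>
  generates \<open>K\<close>, and every subset of \<open>S\<close> is cut out on \<open>S\<close> by such a homomorphism on \<open>K\<close>, then
  \<open>card S \<le> card U\<close>.  Homomorphisms on a subgroup \<open>K\<close> of \<open>F\<close> arise from labellings of the Cayley
  graph of \<open>F\<close> that are invariant under \<open>K\<close>: since the Cayley graph is a tree, such a labelling is
  the coboundary of a potential, and the potential is a homomorphism on \<open>K\<close>.

  If \<open>F = L * M\<close>, every homomorphism on \<open>L \<inter> K\<close> extends in this way to \<open>K\<close>, because the coset graph
  of \<open>L \<inter> K\<close> in \<open>L\<close> embeds into the coset graph of \<open>K\<close>; hence free factors of inert subgroups are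
  inert.  For an infinite intersection, a finite part of the coset graph of the intersection already
  embeds into the coset graph of a finite intersection.  For compressed subgroups, \<open>H = L * M\<close> and
  \<open>L \<le> K\<close> give \<open>rk L + rk M \<le> rk \<langle>K, M\<rangle> \<le> rk K + rk M\<close>.  The inert closure is the intersection of all
  inert subgroups containing \<open>H\<close>, and a free factor of it containing \<open>H\<close> is again inert.
\<close>

subsection \<open>Words\<close>

definition word_val :: "('a, 'b) monoid_scheme \<Rightarrow> (bool \<times> 'a) list \<Rightarrow> 'a" where
  "word_val G w = list_mult G (map (letter_val G) w)"

definition inv_letter :: "bool \<times> 'a \<Rightarrow> bool \<times> 'a" where
  "inv_letter u = (\<not> fst u, snd u)"

lemma inv_letter_inv_letter [simp]: "inv_letter (inv_letter u) = u"
  by (simp add: inv_letter_def)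

lemma snd_inv_letter [simp]: "snd (inv_letter u) = snd u"
  by (simp add: inv_letter_def)

lemma list_mult_simps [simp]:
  "list_mult G [] = \<one>\<^bsub>G\<^esub>" "list_mult G (x # xs) = x \<otimes>\<^bsub>G\<^esub> list_mult G xs"
  by (simp_all add: list_mult_def)

lemma word_val_simps [simp]:
  "word_val G [] = \<one>\<^bsub>G\<^esub>" "word_val G (u # w) = letter_val G u \<otimes>\<^bsub>G\<^esub> word_val G w"
  by (simp_all add: word_val_def)

lemma letter_val_simps [simp]:
  "letter_val G (True, b) = b" "letter_val G (False, b) = inv\<^bsub>G\<^esub> b"
  by (simp_all add: letter_val_def)

lemma (in group) mult_inv_cancel [simp]:
  assumes "x \<in> carrier G" "y \<in> carrier G"
  shows "x \<otimes> (inv x \<otimes> y) = y" "inv x \<otimes> (x \<otimes> y) = y"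
  using assms by (simp_all flip: m_assoc)

lemma (in group) list_mult_closed:
  "set xs \<subseteq> carrier G \<Longrightarrow> list_mult G xs \<in> carrier G"
  by (induction xs) auto

lemma (in group) list_mult_append:
  "set xs \<subseteq> carrier G \<Longrightarrow> set ys \<subseteq> carrier G \<Longrightarrow>
    list_mult G (xs @ ys) = list_mult G xs \<otimes> list_mult G ys"
  by (induction xs) (auto simp: m_assoc list_mult_closed)

lemma (in group) letter_val_closed:
  "snd u \<in> carrier G \<Longrightarrow> letter_val G u \<in> carrier G"
  by (simp add: letter_val_def)

lemma (in group) letter_val_inv_letter:
  "snd u \<in> carrier G \<Longrightarrow> letter_val G (inv_letter u) = inv (letter_val G u)"
  by (simp add: letter_val_def inv_letter_def)

lemma (in group) word_val_closed:
  "B \<subseteq> carrier G \<Longrightarrow> set w \<subseteq> UNIV \<times> B \<Longrightarrow> word_val G w \<in> carrier G"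
  unfolding word_val_def by (rule list_mult_closed) (auto intro!: letter_val_closed)

lemma (in group) word_val_append:
  assumes "B \<subseteq> carrier G" "set v \<subseteq> UNIV \<times> B" "set w \<subseteq> UNIV \<times> B"
  shows "word_val G (v @ w) = word_val G v \<otimes> word_val G w"
  unfolding word_val_def map_append
  by (rule list_mult_append) (use assms in \<open>auto intro!: letter_val_closed\<close>)

lemma reduced_words_Nil [simp]: "[] \<in> reduced_words B"
  by (simp add: reduced_words_def)

lemma reduced_words_Cons:
  "u # w \<in> reduced_words B \<longleftrightarrow>
     snd u \<in> B \<and> w \<in> reduced_words B \<and> (w = [] \<or> hd w \<noteq> inv_letter u)"
  by (cases u; cases w) (auto simp: reduced_words_def inv_letter_def)

lemma set_reduced_word: "w \<in> reduced_words B \<Longrightarrow> set w \<subseteq> UNIV \<times> B"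
  by (simp add: reduced_words_def)

lemma free_basis_iff:
  "free_basis G B \<longleftrightarrow> B \<subseteq> carrier G \<and> bij_betw (word_val G) (reduced_words B) (carrier G)"
  unfolding free_basis_def word_val_def ..

locale free_group = group F for F (structure) +
  fixes B
  assumes basis: "free_basis F B"
begin

lemma basis_subset: "B \<subseteq> carrier F"
  using basis by (simp add: free_basis_def)

lemma basis_closed: "b \<in> B \<Longrightarrow> b \<in> carrier F"
  using basis_subset by blast

lemma letter_closed: "snd u \<in> B \<Longrightarrow> letter_val F u \<in> carrier F"
  by (simp add: letter_val_closed basis_closed)

lemma val_closed: "set w \<subseteq> UNIV \<times> B \<Longrightarrow> word_val F w \<in> carrier F"
  by (rule word_val_closed[OF basis_subset])

lemma val_append:
  "set v \<subseteq> UNIV \<times> B \<Longrightarrow> set w \<subseteq> UNIV \<times> B \<Longrightarrow> word_val F (v @ w) = word_val F v \<otimes> word_val F w"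
  by (rule word_val_append[OF basis_subset])

lemma reduced_inj:
  "v \<in> reduced_words B \<Longrightarrow> w \<in> reduced_words B \<Longrightarrow> word_val F v = word_val F w \<Longrightarrow> v = w"
  using basis unfolding free_basis_iff bij_betw_def by (blast dest: inj_onD)

lemma ex_reduced:
  assumes "g \<in> carrier F"
  obtains w where "w \<in> reduced_words B" "word_val F w = g"
  using basis assms that unfolding free_basis_iff bij_betw_def by (metis imageE)

lemma ex_word:
  assumes "g \<in> carrier F"
  obtains w where "set w \<subseteq> UNIV \<times> B" "word_val F w = g"
  using ex_reduced[OF assms] set_reduced_word by metis

end

subsection \<open>Potentials on the Cayley graph\<close>

text \<open>
  The product of the edge labels \<open>c\<close> along the path that starts at \<open>a\<close> and reads \<open>w\<close> in the Cayley
  graph of \<open>F\<close>; the edge from \<open>a\<close> to \<open>a \<otimes> b\<close> has label \<open>c a b\<close>.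
\<close>

fun walk :: "('a, 'b) monoid_scheme \<Rightarrow> ('c, 'd) monoid_scheme \<Rightarrow> ('a \<Rightarrow> 'a \<Rightarrow> 'c) \<Rightarrow> 'a \<Rightarrow>
    (bool \<times> 'a) list \<Rightarrow> 'c" where
  "walk F P c a [] = \<one>\<^bsub>P\<^esub>"
| "walk F P c a ((e, b) # w) =
     (if e then c a b else inv\<^bsub>P\<^esub> (c (a \<otimes>\<^bsub>F\<^esub> inv\<^bsub>F\<^esub> b) b))
       \<otimes>\<^bsub>P\<^esub> walk F P c (a \<otimes>\<^bsub>F\<^esub> letter_val F (e, b)) w"

locale labelled_free_group = free_group F B + P: group P
  for F (structure) and B and P (structure) +
  fixes c
  assumes label_closed: "\<lbrakk>a \<in> carrier F; b \<in> B\<rbrakk> \<Longrightarrow> c a b \<in> carrier P"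
begin

abbreviation "path \<equiv> walk F P c"

lemma path_closed:
  "a \<in> carrier F \<Longrightarrow> set w \<subseteq> UNIV \<times> B \<Longrightarrow> path a w \<in> carrier P"
proof (induction w arbitrary: a)
  case (Cons u w)
  then show ?case
    by (cases u) (auto simp: label_closed basis_closed)
qed auto

lemma path_append:
  "a \<in> carrier F \<Longrightarrow> set v \<subseteq> UNIV \<times> B \<Longrightarrow> set w \<subseteq> UNIV \<times> B \<Longrightarrow>
    path a (v @ w) = path a v \<otimes>\<^bsub>P\<^esub> path (a \<otimes> word_val F v) w"
proof (induction v arbitrary: a)
  case (Cons u v)
  then show ?case
    by (cases u) (auto simp: label_closed basis_closed path_closed P.m_assoc m_assoc val_closed)
qed (auto simp: path_closed)

text \<open>The pair crosses one edge in both directions, and the two labels stand next to each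
  other in the product, so they cancel even in a nonabelian \<open>P\<close>.\<close>

lemma path_cancel:
  assumes "a \<in> carrier F" "snd u \<in> B" "set w \<subseteq> UNIV \<times> B"
  shows "path a (u # inv_letter u # w) = path a w"
proof -
  obtain e b where u: "u = (e, b)" by (cases u)
  have b: "b \<in> B" "b \<in> carrier F"
    using assms u basis_closed by auto
  have *: "path a w \<in> carrier P" "a \<otimes> b \<otimes> inv b = a" "a \<otimes> inv b \<otimes> b = a"
    using assms b by (auto simp: path_closed m_assoc)
  show ?thesis
    using b assms by (cases e) (auto simp: u inv_letter_def * label_closed)
qed

text \<open>Free reduction from the right: once the tail is reduced, a new first letter allows at
  most one cancellation. This expresses that the Cayley graph is a tree.\<close>

lemma ex_reduced_path:
  "set w \<subseteq> UNIV \<times> B \<Longrightarrow>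
    \<exists>r\<in>reduced_words B. word_val F r = word_val F w \<and> (\<forall>a\<in>carrier F. path a r = path a w)"
proof (induction w)
  case Nil
  then show ?case by (intro bexI[of _ "[]"]) auto
next
  case (Cons u w)
  then obtain r where r: "r \<in> reduced_words B" "word_val F r = word_val F w"
    "\<And>a. a \<in> carrier F \<Longrightarrow> path a r = path a w" by auto
  have u: "snd u \<in> B" using Cons.prems by auto
  have step: "path a (u # r) = path a (u # w)" if "a \<in> carrier F" for a
    using that u by (cases u) (auto simp: r(3) basis_closed)
  show ?case
  proof (cases "u # r \<in> reduced_words B")
    case True
    then show ?thesis using r step by (intro bexI[of _ "u # r"]) auto
  next
    case False
    then obtain r' where r': "r = inv_letter u # r'"
      using r(1) u by (cases r) (auto simp: reduced_words_Cons)
    then have red: "r' \<in> reduced_words B" using r(1) by (simp add: reduced_words_Cons)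
    have "word_val F r' = word_val F (u # w)"
      using r(2) u set_reduced_word[OF red]
      by (simp add: r' letter_val_inv_letter basis_closed letter_closed val_closed
          flip: r(2))
    moreover have "path a r' = path a (u # w)" if "a \<in> carrier F" for a
      using step[OF that] path_cancel[OF that u set_reduced_word[OF red]] by (simp add: r')
    ultimately show ?thesis using red by blast
  qed
qed

text \<open>By freeness the choice picks the unique reduced word for \<open>g\<close>, so this is
  the product of the labels along the geodesic from \<open>\<one>\<close> to
  \<open>g\<close>.\<close>

definition potential :: "'a \<Rightarrow> 'c" where
  "potential g = path \<one> (SOME w. w \<in> reduced_words B \<and> word_val F w = g)"

lemma potential_val:
  assumes w: "set w \<subseteq> UNIV \<times> B"
  shows "potential (word_val F w) = path \<one> w"
proof -
  obtain r where r: "r \<in> reduced_words B" "word_val F r = word_val F w" "path \<one> r = path \<one> w"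
    using ex_reduced_path[OF w] by auto
  then have "(SOME v. v \<in> reduced_words B \<and> word_val F v = word_val F w) = r"
    by (intro some_equality) (auto intro: reduced_inj)
  then show ?thesis by (simp add: potential_def r)
qed

lemma potential_one: "potential \<one> = \<one>\<^bsub>P\<^esub>"
  using potential_val[of "[]"] by simp

lemma potential_closed: "g \<in> carrier F \<Longrightarrow> potential g \<in> carrier P"
  by (metis ex_word one_closed path_closed potential_val)

text \<open>\<open>potential_val\<close> also covers unreduced words, so a word for \<open>g\<close>
  may be extended by \<open>b\<close> whether or not the new letter cancels.\<close>

lemma potential_step:
  assumes "g \<in> carrier F" "b \<in> B"
  shows "potential (g \<otimes> b) = potential g \<otimes>\<^bsub>P\<^esub> c g b"
proof -
  obtain w where w: "set w \<subseteq> UNIV \<times> B" "word_val F w = g" using ex_word[OF assms(1)] .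
  show ?thesis
    using potential_val[of "w @ [(True, b)]"] potential_val[of w] w assms
    by (simp add: path_append val_append basis_closed label_closed)
qed

text \<open>Translation by \<open>k\<close> carries the path from \<open>\<one>\<close> to
  \<open>g\<close> to a path from \<open>k\<close> with the same labels.\<close>

lemma potential_mult:
  assumes K: "subgroup K F"
    and inv: "\<And>k a b. \<lbrakk>k \<in> K; a \<in> carrier F; b \<in> B\<rbrakk> \<Longrightarrow> c (k \<otimes> a) b = c a b"
    and k: "k \<in> K" and g: "g \<in> carrier F"
  shows "potential (k \<otimes> g) = potential k \<otimes>\<^bsub>P\<^esub> potential g"
proof -
  have kF: "k \<in> carrier F" using K k by (rule subgroup.mem_carrier)
  have shift: "path (k \<otimes> a) w = path a w" if "a \<in> carrier F" "set w \<subseteq> UNIV \<times> B" for a w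
    using that
  proof (induction w arbitrary: a)
    case (Cons u w)
    then show ?case
      using kF inv[OF k] by (cases u) (auto simp: m_assoc basis_closed)
  qed auto
  obtain v where v: "set v \<subseteq> UNIV \<times> B" "word_val F v = k" using ex_word[OF kF] .
  obtain w where w: "set w \<subseteq> UNIV \<times> B" "word_val F w = g" using ex_word[OF g] .
  show ?thesis
    using potential_val[of "v @ w"] potential_val[of v] potential_val[of w] v w kF shift[of \<one> w]
    by (simp add: path_append val_append)
qed

end

text \<open>Labels that depend only on the letter are invariant under the whole group, so their
  potential is multiplicative everywhere.\<close>

lemma (in free_group) universal:
  fixes P :: "('c, 'd) monoid_scheme"
  assumes P: "group P" and f: "\<And>b. b \<in> B \<Longrightarrow> f b \<in> carrier P"
  shows "\<exists>h\<in>hom F P. \<forall>b\<in>B. h b = f b"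
proof -
  interpret labelled_free_group F B P "\<lambda>a b. f b"
    using P f by (simp add: labelled_free_group_def free_group_axioms labelled_free_group_axioms_def)
  have "potential b = f b" if "b \<in> B" for b
    using potential_step[of \<one> b] that by (simp add: potential_one basis_closed f)
  moreover have "potential \<in> hom F P"
    using potential_mult[OF subgroup_self] by (auto simp: hom_def potential_closed)
  ultimately show ?thesis by blast
qed

subsection \<open>A criterion for free bases\<close>

text \<open>Left multiplication by a letter on normal forms, as in van der Waerden's trick.\<close>

fun push :: "bool \<times> 'a \<Rightarrow> (bool \<times> 'a) list \<Rightarrow> (bool \<times> 'a) list" where
  "push u [] = [u]"
| "push u (v # w) = (if v = inv_letter u then w else u # v # w)"

lemma push_reduced: "snd u \<in> B \<Longrightarrow> w \<in> reduced_words B \<Longrightarrow> push u w \<in> reduced_words B"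
  by (cases w) (auto simp: reduced_words_Cons)

lemma push_inv_letter: "w \<in> reduced_words B \<Longrightarrow> push u (push (inv_letter u) w) = w"
  by (cases w; cases "tl w") (auto simp: reduced_words_Cons)

lemma push_inv_letter': "w \<in> reduced_words B \<Longrightarrow> push (inv_letter u) (push u w) = w"
  using push_inv_letter[of w B "inv_letter u"] by simp

lemma push_Cons_reduced: "u # w \<in> reduced_words B \<Longrightarrow> push u w = u # w"
  by (cases w) (auto simp: reduced_words_Cons)

text \<open>The restriction makes the map extensional, as membership in \<open>Bij\<close>
  demands.\<close>

definition push_perm :: "'a set \<Rightarrow> bool \<times> 'a \<Rightarrow> (bool \<times> 'a) list \<Rightarrow> (bool \<times> 'a) list" where
  "push_perm B u = restrict (push u) (reduced_words B)"

lemma push_perm_Bij: "snd u \<in> B \<Longrightarrow> push_perm B u \<in> Bij (reduced_words B)"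
  unfolding Bij_def push_perm_def
  by (auto intro!: bij_betw_byWitness[where f' = "push (inv_letter u)"]
      simp: push_reduced push_inv_letter push_inv_letter')

lemma carrier_BijGroup: "carrier (BijGroup S) = Bij S"
  by (simp add: BijGroup_def)

lemma mult_BijGroup_apply:
  "f \<in> Bij S \<Longrightarrow> g \<in> Bij S \<Longrightarrow> x \<in> S \<Longrightarrow> (f \<otimes>\<^bsub>BijGroup S\<^esub> g) x = f (g x)"
  by (simp add: BijGroup_def compose_def)

lemma push_perm_inv:
  assumes "snd u \<in> B"
  shows "inv\<^bsub>BijGroup (reduced_words B)\<^esub> (push_perm B u) = push_perm B (inv_letter u)"
proof (rule group.inv_equality[OF group_BijGroup])
  have "push_perm B (inv_letter u) \<otimes>\<^bsub>BijGroup (reduced_words B)\<^esub> push_perm B u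
      = compose (reduced_words B) (push_perm B (inv_letter u)) (push_perm B u)"
    using assms by (simp add: BijGroup_def push_perm_Bij)
  also have "\<dots> = (\<lambda>x\<in>reduced_words B. x)"
    using assms push_inv_letter'[of _ B u]
    by (auto simp: push_perm_def compose_def push_reduced intro!: restrict_ext)
  finally show "push_perm B (inv_letter u) \<otimes>\<^bsub>BijGroup (reduced_words B)\<^esub> push_perm B u
      = \<one>\<^bsub>BijGroup (reduced_words B)\<^esub>" by (simp add: BijGroup_def)
qed (use assms in \<open>auto simp: carrier_BijGroup push_perm_Bij\<close>)

lemma (in group) generate_eq_word_val:
  assumes "Y \<subseteq> carrier G"
  shows "generate G Y = word_val G ` {w. set w \<subseteq> UNIV \<times> Y}" (is "_ = ?V")
proof
  show "generate G Y \<subseteq> ?V"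
  proof
    fix x assume "x \<in> generate G Y"
    then show "x \<in> ?V"
    proof induction
      case one
      then show ?case by (intro image_eqI[of _ _ "[]"]) auto
    next
      case (incl h)
      then show ?case using assms by (intro image_eqI[of _ _ "[(True, h)]"]) auto
    next
      case (inv h)
      then show ?case using assms by (intro image_eqI[of _ _ "[(False, h)]"]) auto
    next
      case (eng h1 h2)
      then obtain v w where "set v \<subseteq> UNIV \<times> Y" "set w \<subseteq> UNIV \<times> Y"
        "h1 = word_val G v" "h2 = word_val G w" by auto
      then show ?case using word_val_append[OF assms] by (intro image_eqI[of _ _ "v @ w"]) auto
    qed
  qed
  have "word_val G w \<in> generate G Y" if "set w \<subseteq> UNIV \<times> Y" for w
    using that
    by (induction w) (auto simp: letter_val_def intro: generate.intros intro!: generate.eng)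
  then show "?V \<subseteq> generate G Y" by auto
qed

lemma (in free_group) generate_basis: "generate F B = carrier F"
  using generate_eq_word_val[OF basis_subset] val_closed ex_word by (auto simp: image_iff) metis

lemma (in group) word_val_reduce:
  assumes "Y \<subseteq> carrier G" "set w \<subseteq> UNIV \<times> Y"
  shows "\<exists>r\<in>reduced_words Y. word_val G r = word_val G w"
  using assms(2)
proof (induction w)
  case Nil
  then show ?case by (intro bexI[of _ "[]"]) auto
next
  case (Cons u w)
  then obtain r where r: "r \<in> reduced_words Y" "word_val G r = word_val G w" by auto
  have u: "snd u \<in> Y" using Cons.prems by auto
  show ?case
  proof (cases "u # r \<in> reduced_words Y")
    case True
    then show ?thesis using r by (intro bexI[of _ "u # r"]) auto
  next
    case False
    then obtain r' where r': "r = inv_letter u # r'"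
      using r(1) u by (cases r) (auto simp: reduced_words_Cons)
    then have red: "r' \<in> reduced_words Y" using r(1) by (simp add: reduced_words_Cons)
    have "word_val G r' = word_val G (u # w)"
      using r(2) u assms(1) word_val_closed[OF assms(1) set_reduced_word[OF red]]
      by (auto simp: r' letter_val_inv_letter letter_val_closed subset_iff
          simp flip: r(2))
    then show ?thesis using red by blast
  qed
qed

text \<open>The action on reduced words recovers a reduced word from its value.\<close>

lemma (in group) free_basisI:
  assumes Y: "Y \<subseteq> carrier G" and gen: "generate G Y = carrier G"
    and \<phi>: "\<phi> \<in> hom G (BijGroup (reduced_words Y))"
    and push: "\<And>y. y \<in> Y \<Longrightarrow> \<phi> y = push_perm Y (True, y)"
  shows "free_basis G Y"
proof -
  interpret \<phi>: group_hom G "BijGroup (reduced_words Y)" \<phi>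
    using \<phi> by (simp add: group_hom_def group_hom_axioms_def group_BijGroup)
  have letter: "\<phi> (letter_val G u) = push_perm Y u" if "snd u \<in> Y" for u
    using that Y push push_perm_inv[of "(True, snd u)" Y]
    by (cases u) (auto simp: letter_val_def inv_letter_def subset_iff)
  have val: "\<phi> (word_val G w) r = foldr push w r \<and> foldr push w r \<in> reduced_words Y"
    if "set w \<subseteq> UNIV \<times> Y" "r \<in> reduced_words Y" for w r
    using that(1)
  proof (induction w)
    case Nil
    then show ?case using that(2) by (simp add: BijGroup_def)
  next
    case (Cons u w)
    then have u: "snd u \<in> Y" and w: "word_val G w \<in> carrier G"
      using Y by (auto intro: word_val_closed)
    then have "\<phi> (word_val G (u # w)) = push_perm Y u \<otimes>\<^bsub>BijGroup (reduced_words Y)\<^esub> \<phi> (word_val G w)"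
      using Y by (simp add: letter letter_val_closed subset_iff)
    moreover have "\<phi> (word_val G w) \<in> Bij (reduced_words Y)"
      using \<phi>.hom_closed[OF w] by (simp add: carrier_BijGroup)
    ultimately show ?case
      using Cons u that(2) by (simp add: mult_BijGroup_apply push_perm_Bij)
        (simp add: push_perm_def push_reduced)
  qed
  \<comment> \<open>Acting on the empty word: while a reduced word is built up letter by letter, no
    push cancels.\<close>
  have "foldr push w [] = w" if "w \<in> reduced_words Y" for w
    using that
  proof (induction w)
    case (Cons u w)
    then show ?case using push_Cons_reduced[OF Cons.prems] by (simp add: reduced_words_Cons)
  qed simp
  then have "w = \<phi> (word_val G w) []" if "w \<in> reduced_words Y" for w
    using val[OF set_reduced_word[OF that], of "[]"] that by simp
  then have "inj_on (word_val G) (reduced_words Y)"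
    by (metis inj_onI)
  moreover have "word_val G ` reduced_words Y = carrier G"
  proof
    show "word_val G ` reduced_words Y \<subseteq> carrier G"
      using word_val_closed[OF Y] set_reduced_word by blast
    show "carrier G \<subseteq> word_val G ` reduced_words Y"
    proof
      fix x assume "x \<in> carrier G"
      then obtain w where "set w \<subseteq> UNIV \<times> Y" "x = word_val G w"
        using generate_eq_word_val[OF Y] gen by auto
      then show "x \<in> word_val G ` reduced_words Y"
        using word_val_reduce[OF Y] by (metis imageI)
    qed
  qed
  ultimately show ?thesis using Y by (simp add: free_basis_iff bij_betw_def)
qed

subsection \<open>Subgroups of free groups\<close>

text \<open>Applied to letters, it makes the length-lexicographic order on words well-founded and
  total, also for an infinite basis.\<close>

lemma ex_strict_wellorder: "\<exists>r :: 'a rel. wf r \<and> total r"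
proof -
  obtain r :: "'a rel" where r: "Well_order r" "Field r = UNIV"
    using well_ordering by (elim exE conjE)
  then have "wf (r - Id)" "total (r - Id)"
    unfolding well_order_on_def linear_order_on_def total_on_diff_Id by simp_all
  then show ?thesis by (intro exI[of _ "r - Id"] conjI)
qed

text \<open>
  The minimal words representing the cosets \<open>K a\<close> form a Schreier transversal, because a prefix of
  a minimal word is again minimal.
\<close>

lemma (in free_group) schreier_transversal:
  assumes K: "subgroup K F"
  obtains t where
    "\<And>a. a \<in> carrier F \<Longrightarrow> t a \<in> carrier F \<and> t a \<otimes> inv a \<in> K"
    "\<And>k a. k \<in> K \<Longrightarrow> a \<in> carrier F \<Longrightarrow> t (k \<otimes> a) = t a"
    "t \<one> = \<one>"
    "\<And>a. a \<in> carrier F \<Longrightarrow> \<exists>w. set w \<subseteq> UNIV \<times> B \<and> word_val F w = t a \<and>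
        (\<forall>n. t (word_val F (take n w)) = word_val F (take n w))"
proof -
  obtain r :: "(bool \<times> 'a) rel" where r: "wf r" "total r"
    using ex_strict_wellorder by blast
  define R where "R = lenlex r"
  have wf: "wf R" and total: "total R"
    using r by (auto simp: R_def total_lenlex)
  define rep where "rep a w \<longleftrightarrow> set w \<subseteq> UNIV \<times> B \<and> word_val F w \<otimes> inv a \<in> K" for a w
  define least where "least a w \<longleftrightarrow> rep a w \<and> (\<forall>v. rep a v \<longrightarrow> (v, w) \<notin> R)" for a w
  have ex: "\<exists>w. least a w" if a: "a \<in> carrier F" for a
  proof -
    obtain w where "set w \<subseteq> UNIV \<times> B" "word_val F w = a" using ex_word[OF a] .
    then have "w \<in> Collect (rep a)" using a K by (auto simp: rep_def subgroup.one_closed)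
    then show ?thesis using wfE_min[OF wf, of w "Collect (rep a)"] by (metis least_def mem_Collect_eq)
  qed
  have unique: "v = w" if "least a v" "least a w" for a v w
    using that total unfolding least_def total_on_def by blast
  have rep_cong: "rep a = rep a'" if "a \<in> carrier F" "a' \<in> carrier F" "a \<otimes> inv a' \<in> K" for a a'
  proof (rule ext)
    fix w
    show "rep a w = rep a' w"
    proof (cases "set w \<subseteq> UNIV \<times> B")
      case True
      then have w: "word_val F w \<in> carrier F" by (rule val_closed)
      have "word_val F w \<otimes> inv a \<otimes> (a \<otimes> inv a') = word_val F w \<otimes> inv a'"
        "word_val F w \<otimes> inv a' \<otimes> inv (a \<otimes> inv a') = word_val F w \<otimes> inv a"
        using w that by (simp_all add: m_assoc inv_mult_group)
      then have "word_val F w \<otimes> inv a \<in> K \<longleftrightarrow> word_val F w \<otimes> inv a' \<in> K"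
        using subgroup.m_closed[OF K _ that(3)]
          subgroup.m_closed[OF K _ subgroup.m_inv_closed[OF K that(3)]] by metis
      then show ?thesis by (simp add: rep_def)
    qed (simp add: rep_def)
  qed
  \<comment> \<open>The choice depends on \<open>a\<close> only through \<open>rep a\<close>, which
    is the same predicate for the whole right coset, so \<open>t\<close> is constant on
    cosets.\<close>
  define m where "m a = (SOME w. least a w)" for a
  have m: "least a (m a)" if "a \<in> carrier F" for a
    unfolding m_def using ex[OF that] by (rule someI_ex)
  have m_cong: "m a = m a'" if "a \<in> carrier F" "a' \<in> carrier F" "a \<otimes> inv a' \<in> K" for a a'
    using rep_cong[OF that] by (simp add: m_def least_def)
  define t where "t a = word_val F (m a)" for a
  have t: "t a \<in> carrier F \<and> t a \<otimes> inv a \<in> K" if "a \<in> carrier F" for a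
    using m[OF that] by (auto simp: least_def rep_def t_def val_closed)
  \<comment> \<open>A smaller representative of the coset of \<open>v\<close> could replace
    \<open>v\<close> in \<open>v @ w\<close> and would give a smaller representative of
    \<open>K a\<close>.\<close>
  have prefix: "least (word_val F v) v"
    if "least a (v @ w)" "a \<in> carrier F" for a v w
    unfolding least_def
  proof (intro conjI allI impI notI)
    have vw: "set v \<subseteq> UNIV \<times> B" "set w \<subseteq> UNIV \<times> B" "word_val F (v @ w) \<otimes> inv a \<in> K"
      using that by (auto simp: least_def rep_def)
    then show "rep (word_val F v) v"
      using K by (simp add: rep_def val_closed subgroup.one_closed)
    fix v' assume v': "rep (word_val F v) v'" "(v', v) \<in> R"
    then have less: "(v' @ w, v @ w) \<in> R" by (simp add: R_def lenlex_append1)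
    have "word_val F v' \<otimes> inv (word_val F v) \<otimes> (word_val F v \<otimes> word_val F w \<otimes> inv a)
        = word_val F v' \<otimes> word_val F w \<otimes> inv a"
      using v' vw that(2) val_closed[of v] val_closed[of w] val_closed[of v']
      by (simp add: rep_def m_assoc)
    moreover have "word_val F v' \<otimes> inv (word_val F v) \<in> K" "word_val F v \<otimes> word_val F w \<otimes> inv a \<in> K"
      using v' vw by (auto simp: rep_def val_append)
    ultimately have "word_val F v' \<otimes> word_val F w \<otimes> inv a \<in> K"
      using subgroup.m_closed[OF K] by metis
    then have "rep a (v' @ w)"
      using v' vw by (simp add: rep_def val_append)
    with less show False using that(1) by (simp add: least_def)
  qed
  have t_fix: "t (word_val F v) = word_val F v" if "least (word_val F v) v" for v
  proof -
    have "word_val F v \<in> carrier F" using that by (auto simp: least_def rep_def val_closed)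
    then have "m (word_val F v) = v" using unique[OF m that] by blast
    then show ?thesis by (simp add: t_def)
  qed
  show thesis
  proof
    show "t (k \<otimes> a) = t a" if "k \<in> K" "a \<in> carrier F" for k a
    proof -
      have "k \<in> carrier F" using K that by (simp add: subgroup.mem_carrier)
      then show ?thesis using m_cong[of "k \<otimes> a" a] that by (simp add: t_def m_assoc)
    qed
    have "least \<one> []"
      using K by (auto simp: least_def rep_def R_def subgroup.one_closed)
    then show "t \<one> = \<one>" using t_fix[of "[]"] by simp
    show "\<exists>w. set w \<subseteq> UNIV \<times> B \<and> word_val F w = t a \<and>
        (\<forall>n. t (word_val F (take n w)) = word_val F (take n w))" if a: "a \<in> carrier F" for a
    proof (intro exI[of _ "m a"] conjI allI)
      show "set (m a) \<subseteq> UNIV \<times> B" using m[OF a] by (simp add: least_def rep_def)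
      show "word_val F (m a) = t a" by (simp add: t_def)
      fix n
      show "t (word_val F (take n (m a))) = word_val F (take n (m a))"
        by (rule t_fix, rule prefix[where a = a and w = "drop n (m a)"]) (use m[OF a] a in auto)
    qed
  qed (use t in blast)
qed

text \<open>The nontrivial Schreier generators form a basis. They generate by rewriting words
  through the transversal, and the action required by \<open>free_basisI\<close> is the potential of
  the labelling that sends each edge to the push of its Schreier generator.\<close>

theorem (in free_group) nielsen_schreier:
  assumes K: "subgroup K F"
  shows "\<exists>Y. free_basis (F\<lparr>carrier := K\<rparr>) Y"
proof -
  obtain t where t: "\<And>a. a \<in> carrier F \<Longrightarrow> t a \<in> carrier F" "\<And>a. a \<in> carrier F \<Longrightarrow> t a \<otimes> inv a \<in> K"
    and t_inv: "\<And>k a. k \<in> K \<Longrightarrow> a \<in> carrier F \<Longrightarrow> t (k \<otimes> a) = t a"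
    and t_one: "t \<one> = \<one>"
    and t_word: "\<And>a. a \<in> carrier F \<Longrightarrow> \<exists>w. set w \<subseteq> UNIV \<times> B \<and> word_val F w = t a \<and>
        (\<forall>n. t (word_val F (take n w)) = word_val F (take n w))"
    using schreier_transversal[OF K] by metis
  have KF: "k \<in> carrier F" if "k \<in> K" for k
    using K that by (rule subgroup.mem_carrier)
  \<comment> \<open>The Schreier generator of the edge from \<open>a\<close> to
    \<open>a \<otimes> b\<close>; it depends on \<open>a\<close> only through the coset
    \<open>K a\<close>.\<close>
  define s where "s a b = t a \<otimes> b \<otimes> inv (t (a \<otimes> b))" for a b
  have t_t: "t (t a) = t a" "t (t a \<otimes> b) = t (a \<otimes> b)"
    if a: "a \<in> carrier F" "b \<in> B" for a b
  proof -
    have "t a = (t a \<otimes> inv a) \<otimes> a" "t a \<otimes> b = (t a \<otimes> inv a) \<otimes> (a \<otimes> b)"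
      using t[OF a(1)] a basis_closed by (auto simp: m_assoc)
    then show "t (t a) = t a" "t (t a \<otimes> b) = t (a \<otimes> b)"
      using t_inv[OF t(2)[OF a(1)]] a basis_closed by (metis m_closed)+
  qed
  have s_K: "s a b \<in> K" if a: "a \<in> carrier F" "b \<in> B" for a b
  proof -
    have "s a b = (t a \<otimes> inv a) \<otimes> inv (t (a \<otimes> b) \<otimes> inv (a \<otimes> b))"
      using t a basis_closed[OF a(2)] unfolding s_def
      by (simp add: m_assoc inv_mult_group)
    then show ?thesis
      using t(2) a basis_closed[OF a(2)] K
      by (simp add: subgroup.m_closed subgroup.m_inv_closed)
  qed
  have s_mult: "s a b \<otimes> t (a \<otimes> b) = t a \<otimes> b" if "a \<in> carrier F" "b \<in> B" for a b
    using that t basis_closed by (simp add: s_def m_assoc)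
  define Y where "Y = {s a b | a b. a \<in> carrier F \<and> b \<in> B \<and> s a b \<noteq> \<one>}"
  have Y_K: "Y \<subseteq> K" using s_K by (auto simp: Y_def)
  define P where "P = BijGroup (reduced_words Y)"
  define c where "c a b = (if s a b = \<one> then \<one>\<^bsub>P\<^esub> else push_perm Y (True, s a b))" for a b
  have gP: "group P" by (simp add: P_def group_BijGroup)
  then interpret P: group P .
  interpret labelled_free_group F B P c
  proof
    fix a b assume "a \<in> carrier F" "b \<in> B"
    then have "s a b \<noteq> \<one> \<Longrightarrow> s a b \<in> Y" by (auto simp: Y_def)
    then show "c a b \<in> carrier P"
      by (auto simp: c_def) (auto simp: P_def carrier_BijGroup intro!: push_perm_Bij)
  qed
  have c_inv: "c (k \<otimes> a) b = c a b" if "k \<in> K" "a \<in> carrier F" "b \<in> B" for k a b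
    using that t_inv[of k a] t_inv[of k "a \<otimes> b"] KF basis_closed
    by (simp add: c_def s_def m_assoc)
  have mult: "potential (k \<otimes> g) = potential k \<otimes>\<^bsub>P\<^esub> potential g" if "k \<in> K" "g \<in> carrier F" for k g
    using potential_mult[OF K c_inv that] by blast
  \<comment> \<open>All prefixes of \<open>w\<close> represent themselves, so each edge crossed has
    a trivial Schreier generator and a neutral label.\<close>
  have tree: "potential (word_val F w) = \<one>\<^bsub>P\<^esub>"
    if "set w \<subseteq> UNIV \<times> B" "\<And>n. t (word_val F (take n w)) = word_val F (take n w)" for w
    using that
  proof (induction w rule: rev_induct)
    case Nil
    then show ?case by (simp add: potential_one)
  next
    case (snoc u w)
    obtain e b where u: "u = (e, b)" by (cases u)
    have "set w \<subseteq> UNIV \<times> B" "b \<in> B" using snoc.prems(1) u by auto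
    then have w: "word_val F w \<in> carrier F" "b \<in> B" "b \<in> carrier F"
      by (auto simp: val_closed basis_closed)
    have tw: "t (word_val F (take n w)) = word_val F (take n w)" for n
      using snoc.prems(2)[of "min n (length w)"] by (cases "n \<le> length w") auto
    have IH: "potential (word_val F w) = \<one>\<^bsub>P\<^esub>"
      by (rule snoc.IH) (use snoc.prems tw in auto)
    have wu: "word_val F (w @ [u]) = word_val F w \<otimes> letter_val F u"
      using snoc.prems(1) w by (simp add: val_append letter_closed u)
    have t_w: "t (word_val F w) = word_val F w"
      using tw[of "length w"] by simp
    have t_wu: "t (word_val F w \<otimes> letter_val F u) = word_val F w \<otimes> letter_val F u"
      using snoc.prems(2)[of "length (w @ [u])"] wu by simp
    show ?case
    proof (cases e)
      case True
      then have "s (word_val F w) b = \<one>" using t_w t_wu w by (simp add: s_def u)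
      then have "c (word_val F w) b = \<one>\<^bsub>P\<^esub>" by (simp add: c_def)
      then show ?thesis using potential_step[OF w(1,2)] IH True wu by (simp add: u)
    next
      case False
      \<comment> \<open>An inverse letter crosses its edge backwards, so the edge starts at the
        endpoint of the extended word.\<close>
      define a where "a = word_val F w \<otimes> inv b"
      have a: "a \<in> carrier F" "a \<otimes> b = word_val F w" using w by (auto simp: a_def m_assoc)
      have "t a = a" using t_wu False by (simp add: u a_def)
      then have "s a b = \<one>" using a t_w w by (simp add: s_def)
      then have "c a b = \<one>\<^bsub>P\<^esub>" by (simp add: c_def)
      then show ?thesis
        using potential_step[OF a(1) w(2)] IH False a potential_closed[OF a(1)] wu
        by (simp add: u flip: a_def)
    qed
  qed
  have pot_t: "potential (t a) = \<one>\<^bsub>P\<^esub>" if "a \<in> carrier F" for a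
    using t_word[OF that] tree by metis
  \<comment> \<open>\<open>potential (t a \<otimes> b)\<close> is computed twice: along the edge
    from \<open>t a\<close>, where only the last label contributes, and from
    \<open>t a \<otimes> b = y \<otimes> t (a \<otimes> b)\<close>, where only
    \<open>potential y\<close> remains.\<close>
  have pot_Y: "potential y = push_perm Y (True, y)" if y: "y \<in> Y" for y
  proof -
    obtain a b where ab: "y = s a b" "a \<in> carrier F" "b \<in> B" "y \<noteq> \<one>"
      using y by (auto simp: Y_def)
    have yK: "y \<in> K" using y Y_K by auto
    have "s (t a) b = y" using ab t_t by (simp add: s_def)
    then have "c (t a) b = push_perm Y (True, y)"
      using ab by (simp add: c_def)
    then have "potential (t a \<otimes> b) = push_perm Y (True, y)"
      using potential_step[OF t(1)[OF ab(2)] ab(3)] pot_t[OF ab(2)] ab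
        label_closed[OF t(1)[OF ab(2)] ab(3)] by simp
    moreover have "potential (t a \<otimes> b) = potential y"
      using mult[OF yK, of "t (a \<otimes> b)"] s_mult[OF ab(2,3)] pot_t[of "a \<otimes> b"] ab basis_closed t KF[OF yK]
        potential_closed[of y] by simp
    ultimately show ?thesis by simp
  qed
  interpret K: group "F\<lparr>carrier := K\<rparr>" by (rule subgroup_imp_group[OF K])
  have Y_F: "Y \<subseteq> carrier F" using Y_K KF by blast
  have subY: "subgroup (generate F Y) F" by (rule generate_is_subgroup[OF Y_F])
  have s_gen: "s a b \<in> generate F Y" if "a \<in> carrier F" "b \<in> B" for a b
    using that by (cases "s a b = \<one>") (auto simp: Y_def intro: generate.intros)
  \<comment> \<open>Reidemeister-Schreier rewriting: carrying the coset representative through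
    \<open>w\<close> leaves one Schreier generator or its inverse per letter.\<close>
  have gen: "\<exists>y\<in>generate F Y. word_val F w = y \<otimes> t (word_val F w)" if "set w \<subseteq> UNIV \<times> B" for w
    using that
  proof (induction w rule: rev_induct)
    case Nil
    then show ?case by (auto simp: t_one intro!: bexI[of _ \<one>] generate.one)
  next
    case (snoc u w)
    obtain e b where u: "u = (e, b)" by (cases u)
    have "set w \<subseteq> UNIV \<times> B" "b \<in> B" using snoc.prems(1) u by auto
    then have w: "word_val F w \<in> carrier F" "b \<in> B" "b \<in> carrier F"
      by (auto simp: val_closed basis_closed)
    have wu: "word_val F (w @ [u]) = word_val F w \<otimes> letter_val F u"
      using snoc.prems(1) w by (simp add: val_append letter_closed u)
    obtain y where y: "y \<in> generate F Y" "word_val F w = y \<otimes> t (word_val F w)"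
      using snoc by auto
    have yF: "y \<in> carrier F" using y generate_in_carrier[OF Y_F] by blast
    show ?case
    proof (cases e)
      case True
      let ?z = "s (word_val F w) b"
      have z: "?z \<in> generate F Y" "?z \<in> carrier F"
        using s_gen[OF w(1,2)] s_K[OF w(1,2)] KF by auto
      have "word_val F w \<otimes> b = y \<otimes> t (word_val F w) \<otimes> b" using y(2) by simp
      also have "\<dots> = y \<otimes> (?z \<otimes> t (word_val F w \<otimes> b))"
        using w t yF s_mult[OF w(1,2)] by (simp add: m_assoc)
      also have "\<dots> = y \<otimes> ?z \<otimes> t (word_val F w \<otimes> b)"
        using w t yF z by (simp add: m_assoc)
      finally show ?thesis using wu True y z by (auto simp: u intro: generate.eng)
    next
      case False
      define a where "a = word_val F w \<otimes> inv b"
      have a: "a \<in> carrier F" "a \<otimes> b = word_val F w" using w by (auto simp: a_def m_assoc)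
      let ?z = "s a b"
      have z: "?z \<in> generate F Y" "?z \<in> carrier F"
        using s_gen[OF a(1) w(2)] s_K[OF a(1) w(2)] KF by auto
      have *: "t (word_val F w) \<otimes> inv b = inv ?z \<otimes> t a"
        using s_mult[OF a(1) w(2)] a w t[OF a(1)] t[OF w(1)] z
        by (metis inv_closed inv_solve_left inv_solve_right m_assoc m_closed)
      have "a = y \<otimes> t (word_val F w) \<otimes> inv b" using y(2) by (simp add: a_def)
      also have "\<dots> = y \<otimes> (inv ?z \<otimes> t a)"
        using w t yF by (simp add: m_assoc *)
      also have "\<dots> = y \<otimes> inv ?z \<otimes> t a"
        using a t yF z by (simp add: m_assoc)
      finally have "a = y \<otimes> inv ?z \<otimes> t a" .
      moreover have "y \<otimes> inv ?z \<in> generate F Y"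
        using y z generate_m_inv_closed[OF Y_F] by (auto intro: generate.eng)
      ultimately show ?thesis using wu False by (auto simp: u simp flip: a_def)
    qed
  qed
  have "generate F Y = K"
  proof
    show "generate F Y \<subseteq> K" using generate_subgroup_incl[OF Y_K K] .
    show "K \<subseteq> generate F Y"
    proof
      fix k assume k: "k \<in> K"
      obtain w where w: "set w \<subseteq> UNIV \<times> B" "word_val F w = k" using ex_word[OF KF[OF k]] .
      have "t k = \<one>" using t_inv[OF k one_closed] KF[OF k] by (simp add: t_one)
      then show "k \<in> generate F Y"
        using gen[OF w(1)] w(2) generate_in_carrier[OF Y_F] by auto
    qed
  qed
  then have "generate (F\<lparr>carrier := K\<rparr>) Y = K"
    using generate_consistent[OF Y_K K] by simp
  moreover have "potential \<in> hom (F\<lparr>carrier := K\<rparr>) P"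
    using mult by (auto simp: hom_def potential_closed KF)
  ultimately have "free_basis (F\<lparr>carrier := K\<rparr>) Y"
    using Y_K pot_Y by (intro K.free_basisI[where \<phi> = potential]) (auto simp: P_def)
  then show ?thesis by blast
qed

subsection \<open>Free products\<close>

lemma (in group) word_val_restrict:
  assumes "subgroup H G" "set w \<subseteq> UNIV \<times> H"
  shows "word_val (G\<lparr>carrier := H\<rparr>) w = word_val G w"
  using assms(2)
  by (induction w) (auto simp: letter_val_def m_inv_consistent[OF assms(1)])

lemma (in group) subsubgroup_imp_group_iff:
  assumes "subgroup H G"
  shows "subgroup K (G\<lparr>carrier := H\<rparr>) \<longleftrightarrow> subgroup K G \<and> K \<subseteq> H"
  using incl_subgroup[OF assms, of K] subgroup_incl[OF _ assms, of K]
    subgroup.subset[of K "G\<lparr>carrier := H\<rparr>"] by (auto simp: subset_iff)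

text \<open>Alternating normal forms define the map. It is multiplicative because every sequence
  from the two factors reduces to an alternating one by deletions and merges that preserve the
  values in \<open>G\<close> and in \<open>P\<close> simultaneously.\<close>

lemma (in group) free_product_universal:
  fixes P :: "('c, 'd) monoid_scheme"
  assumes fp: "is_free_product G L M" and P: "group P"
    and f: "f \<in> hom (G\<lparr>carrier := L\<rparr>) P" and g: "g \<in> hom (G\<lparr>carrier := M\<rparr>) P"
  shows "\<exists>h\<in>hom G P. (\<forall>l\<in>L. h l = f l) \<and> (\<forall>m\<in>M. h m = g m)"
proof -
  interpret P: group P by fact
  have L: "subgroup L G" and M: "subgroup M G"
    using fp by (auto simp: is_free_product_def)
  have f': "f x \<in> carrier P" "f (x \<otimes> y) = f x \<otimes>\<^bsub>P\<^esub> f y" if "x \<in> L" "y \<in> L" for x y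
    using f that by (auto simp: hom_def)
  have g': "g x \<in> carrier P" "g (x \<otimes> y) = g x \<otimes>\<^bsub>P\<^esub> g y" if "x \<in> M" "y \<in> M" for x y
    using g that by (auto simp: hom_def)
  have one: "f \<one> = \<one>\<^bsub>P\<^esub>" "g \<one> = \<one>\<^bsub>P\<^esub>"
    using hom_one[OF f subgroup_imp_group[OF L] P] hom_one[OF g subgroup_imp_group[OF M] P] by auto
  define \<phi> where "\<phi> = case_sum id (id :: 'a \<Rightarrow> 'a)"
  define \<psi> where "\<psi> = case_sum f g"
  define S where "S = Inl ` L \<union> Inr ` M"
  have \<phi>: "\<phi> u \<in> carrier G" and \<psi>: "\<psi> u \<in> carrier P" if "u \<in> S" for u
    using that f' g' L M subgroup.subset by (fastforce simp: S_def \<phi>_def \<psi>_def)+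
  have trivial: "\<psi> u = \<one>\<^bsub>P\<^esub>" if "u \<in> S" "\<phi> u = \<one>" for u
    using that one by (auto simp: S_def \<phi>_def \<psi>_def)
  have merge: "\<exists>x\<in>S. isl x = isl u \<and> \<phi> x = \<phi> u \<otimes> \<phi> v \<and> \<psi> x = \<psi> u \<otimes>\<^bsub>P\<^esub> \<psi> v"
    if "u \<in> S" "v \<in> S" "isl u = isl v" for u v
  proof (cases u)
    case (Inl l)
    from that Inl obtain l' where "v = Inl l'" by (cases v) auto
    then show ?thesis using that Inl f' subgroup.m_closed[OF L]
      by (intro bexI[of _ "Inl (l \<otimes> l')"]) (auto simp: S_def \<phi>_def \<psi>_def)
  next
    case (Inr l)
    from that Inr obtain l' where "v = Inr l'" by (cases v) auto
    then show ?thesis using that Inr g' subgroup.m_closed[OF M]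
      by (intro bexI[of _ "Inr (l \<otimes> l')"]) (auto simp: S_def \<phi>_def \<psi>_def)
  qed
  have alt: "w \<in> alternating_words G L M \<longleftrightarrow>
      (\<forall>u\<in>set w. u \<in> S \<and> \<phi> u \<noteq> \<one>) \<and> successively (\<lambda>u v. isl u \<noteq> isl v) w" for w
    by (auto simp: alternating_words_def S_def \<phi>_def)
  define gv where "gv w = list_mult G (map \<phi> w)" for w
  define pv where "pv w = list_mult P (map \<psi> w)" for w
  have gv_closed: "gv w \<in> carrier G" and pv_closed: "pv w \<in> carrier P" if "set w \<subseteq> S" for w
    using that \<phi> \<psi> by (auto simp: gv_def pv_def subset_iff intro!: list_mult_closed P.list_mult_closed)
  have append: "gv (v @ w) = gv v \<otimes> gv w" "pv (v @ w) = pv v \<otimes>\<^bsub>P\<^esub> pv w"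
    if "set v \<subseteq> S" "set w \<subseteq> S" for v w
    unfolding gv_def pv_def map_append
    by (rule list_mult_append P.list_mult_append; use that \<phi> \<psi> in \<open>auto simp: subset_iff\<close>)+
  have reduce: "\<exists>r\<in>alternating_words G L M. gv r = gv w \<and> pv r = pv w" if "set w \<subseteq> S" for w
    using that
  proof (induction w)
    case Nil
    then show ?case by (intro bexI[of _ "[]"]) (auto simp: alt)
  next
    case (Cons u w)
    then obtain r where r: "r \<in> alternating_words G L M" "gv r = gv w" "pv r = pv w" by auto
    have u: "u \<in> S" using Cons.prems by auto
    have eqs: "gv (u # w) = \<phi> u \<otimes> gv r" "pv (u # w) = \<psi> u \<otimes>\<^bsub>P\<^esub> pv r"
      using r by (auto simp: gv_def pv_def)
    \<comment> \<open>In the last case the tail \<open>r'\<close> is empty or starts in the other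
      factor, so one merge, possibly followed by one deletion, restores alternation.\<close>
    consider "\<phi> u = \<one>" | "\<phi> u \<noteq> \<one>" "r = [] \<or> isl (hd r) \<noteq> isl u"
      | v r' where "\<phi> u \<noteq> \<one>" "r = v # r'" "isl u = isl v"
      by (cases r) auto
    then show ?case
    proof cases
      case 1
      then show ?thesis
        using r u trivial eqs gv_closed[of w] pv_closed[of w] Cons.prems by (intro bexI[of _ r]) auto
    next
      case 2
      then have "u # r \<in> alternating_words G L M"
        using r u by (cases r) (auto simp: alt)
      then show ?thesis using eqs by (intro bexI[of _ "u # r"]) (auto simp: gv_def pv_def)
    next
      case 3
      then have v: "v \<in> S" and r': "set r' \<subseteq> S" "r' \<in> alternating_words G L M"
        using r(1) by (cases r'; auto simp: alt)+
      obtain x where x: "x \<in> S" "isl x = isl u" "\<phi> x = \<phi> u \<otimes> \<phi> v" "\<psi> x = \<psi> u \<otimes>\<^bsub>P\<^esub> \<psi> v"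
        using merge[OF u v 3(3)] by blast
      have eqs': "gv (u # w) = \<phi> x \<otimes> gv r'" "pv (u # w) = \<psi> x \<otimes>\<^bsub>P\<^esub> pv r'"
        using eqs x u v \<phi> \<psi> gv_closed[OF r'(1)] pv_closed[OF r'(1)] 3
        by (auto simp: gv_def pv_def m_assoc P.m_assoc)
      show ?thesis
      proof (cases "\<phi> x = \<one>")
        case True
        then show ?thesis
          using r' eqs' trivial[OF x(1)] gv_closed[OF r'(1)] pv_closed[OF r'(1)] by (intro bexI[of _ r']) auto
      next
        case False
        then have "x # r' \<in> alternating_words G L M"
          using r(1) x 3 by (cases r') (auto simp: alt)
        then show ?thesis using eqs' by (intro bexI[of _ "x # r'"]) (auto simp: gv_def pv_def)
      qed
    qed
  qed
  have bij: "bij_betw gv (alternating_words G L M) (carrier G)"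
    using fp unfolding is_free_product_def gv_def[abs_def] \<phi>_def by blast
  define h where "h x = pv (the_inv_into (alternating_words G L M) gv x)" for x
  have h: "h (gv w) = pv w" if w: "set w \<subseteq> S" for w
  proof -
    obtain r where r: "r \<in> alternating_words G L M" "gv r = gv w" "pv r = pv w"
      using reduce[OF w] by blast
    then have "the_inv_into (alternating_words G L M) gv (gv w) = r"
      using bij by (metis bij_betw_def the_inv_into_f_f)
    then show ?thesis using r by (simp add: h_def)
  qed
  have ex: "\<exists>w. set w \<subseteq> S \<and> gv w = x" if "x \<in> carrier G" for x
    using bij that unfolding bij_betw_def by (force simp: alt)
  have "h \<in> hom G P"
  proof (rule homI)
    fix x y assume "x \<in> carrier G" "y \<in> carrier G"
    then obtain v w where vw: "set v \<subseteq> S" "gv v = x" "set w \<subseteq> S" "gv w = y"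
      using ex by metis
    then show "h (x \<otimes> y) = h x \<otimes>\<^bsub>P\<^esub> h y"
      using h[of "v @ w"] h[of v] h[of w] by (simp add: append)
  qed (use ex h pv_closed in metis)
  moreover have "h l = f l" if "l \<in> L" for l
    using h[of "[Inl l]"] that f' subgroup.mem_carrier[OF L] by (simp add: S_def gv_def pv_def \<phi>_def \<psi>_def)
  moreover have "h m = g m" if "m \<in> M" for m
    using h[of "[Inr m]"] that g' subgroup.mem_carrier[OF M] by (simp add: S_def gv_def pv_def \<phi>_def \<psi>_def)
  ultimately show ?thesis by blast
qed

lemma (in free_group) one_not_in_basis: "\<one> \<notin> B"
proof
  assume "\<one> \<in> B"
  then have "[] = [(True, \<one>)]"
    by (intro reduced_inj) (auto simp: reduced_words_Cons)
  then show False by simp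
qed

lemma free_groupI: "group G \<Longrightarrow> free_basis G U \<Longrightarrow> free_group G U"
  by (simp add: free_group_def free_group_axioms_def)

text \<open>By the two universal properties the pushes by letters of \<open>Y \<union> Z\<close>
  extend first to \<open>L\<close> and \<open>M\<close> and then to \<open>G\<close>, which is the
  action that \<open>free_basisI\<close> asks for.\<close>

lemma (in group) free_product_basis:
  assumes fp: "is_free_product G L M"
    and Y: "free_basis (G\<lparr>carrier := L\<rparr>) Y" and Z: "free_basis (G\<lparr>carrier := M\<rparr>) Z"
  shows "free_basis G (Y \<union> Z)" "Y \<inter> Z = {}"
proof -
  have L: "subgroup L G" and M: "subgroup M G"
    using fp by (auto simp: is_free_product_def)
  interpret L: free_group "G\<lparr>carrier := L\<rparr>" Y
    by (rule free_groupI[OF subgroup_imp_group[OF L] Y])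
  interpret M: free_group "G\<lparr>carrier := M\<rparr>" Z
    by (rule free_groupI[OF subgroup_imp_group[OF M] Z])
  have YL: "Y \<subseteq> L" and ZM: "Z \<subseteq> M" using L.basis_subset M.basis_subset by auto
  then have YZ: "Y \<union> Z \<subseteq> carrier G"
    using subgroup.subset[OF L] subgroup.subset[OF M] by blast
  let ?P = "BijGroup (reduced_words (Y \<union> Z))"
  have perm: "push_perm (Y \<union> Z) (True, u) \<in> carrier ?P" if "u \<in> Y \<union> Z" for u
    using that by (simp add: carrier_BijGroup push_perm_Bij)
  obtain f where f: "f \<in> hom (G\<lparr>carrier := L\<rparr>) ?P" "\<And>y. y \<in> Y \<Longrightarrow> f y = push_perm (Y \<union> Z) (True, y)"
    using L.universal[OF group_BijGroup, of "\<lambda>y. push_perm (Y \<union> Z) (True, y)" "reduced_words (Y \<union> Z)"]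
      perm by blast
  obtain g where g: "g \<in> hom (G\<lparr>carrier := M\<rparr>) ?P" "\<And>y. y \<in> Z \<Longrightarrow> g y = push_perm (Y \<union> Z) (True, y)"
    using M.universal[OF group_BijGroup, of "\<lambda>y. push_perm (Y \<union> Z) (True, y)" "reduced_words (Y \<union> Z)"]
      perm by blast
  obtain h where h: "h \<in> hom G ?P" "\<forall>l\<in>L. h l = f l" "\<forall>m\<in>M. h m = g m"
    using free_product_universal[OF fp group_BijGroup f(1) g(1)] by blast
  have "L \<union> M \<subseteq> generate G (Y \<union> Z)"
    using generate_consistent[OF YL L] generate_consistent[OF ZM M] L.generate_basis M.generate_basis
      mono_generate[of Y "Y \<union> Z"] mono_generate[of Z "Y \<union> Z"] by simp
  then have "list_mult G (map (case_sum id id) w) \<in> generate G (Y \<union> Z)"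
    if "w \<in> alternating_words G L M" for w
  proof -
    assume LM: "L \<union> M \<subseteq> generate G (Y \<union> Z)"
    have "set w \<subseteq> Inl ` L \<union> Inr ` M" using that by (auto simp: alternating_words_def)
    then show ?thesis
      using LM by (induction w) (auto intro: generate.one intro!: generate.eng)
  qed
  moreover have "\<exists>w\<in>alternating_words G L M. x = list_mult G (map (case_sum id id) w)"
    if "x \<in> carrier G" for x
    using fp that by (auto simp: is_free_product_def bij_betw_def image_iff)
  ultimately have "generate G (Y \<union> Z) = carrier G"
    using generate_incl[OF YZ] by (intro equalityI subsetI) auto
  then show "free_basis G (Y \<union> Z)"
    using YZ h f(2) g(2) YL ZM by (intro free_basisI[where \<phi> = h]) auto
  show "Y \<inter> Z = {}"
  proof (rule ccontr)
    assume "Y \<inter> Z \<noteq> {}"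
    then obtain y where y: "y \<in> Y" "y \<in> Z" by blast
    then have "y \<noteq> \<one>" using L.one_not_in_basis by auto
    \<comment> \<open>The tags keep these two words distinct although both have value
      \<open>y\<close>.\<close>
    then have "[Inl y] \<in> alternating_words G L M" "[Inr y] \<in> alternating_words G L M"
      using y YL ZM by (auto simp: alternating_words_def)
    moreover have "inj_on (\<lambda>w. list_mult G (map (case_sum id id) w)) (alternating_words G L M)"
      using fp by (simp add: is_free_product_def bij_betw_def)
    ultimately have "[Inl y] = [Inr y]" by (rule inj_onD[rotated -2]) simp
    then show False by simp
  qed
qed

subsection \<open>Homomorphisms to the group of order two\<close>

text \<open>
  Homomorphisms to the group of order two detect the rank: a free group with a basis of \<open>n\<close>
  elements has exactly \<open>2 ^ n\<close> of them.
\<close>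

definition bool_group :: "bool monoid" where
  "bool_group = \<lparr>carrier = UNIV, monoid.mult = (\<noteq>), one = False\<rparr>"

lemma bool_group_simps [simp]:
  "carrier bool_group = UNIV" "x \<otimes>\<^bsub>bool_group\<^esub> y \<longleftrightarrow> x \<noteq> y" "\<one>\<^bsub>bool_group\<^esub> \<longleftrightarrow> False"
  by (simp_all add: bool_group_def)

lemma group_bool_group: "group bool_group"
  by (rule groupI) auto

lemma (in group) hom_eq_on_generate:
  assumes "group P" "\<phi> \<in> hom G P" "\<psi> \<in> hom G P" "U \<subseteq> carrier G" "\<And>x. x \<in> U \<Longrightarrow> \<phi> x = \<psi> x"
    and "g \<in> generate G U"
  shows "\<phi> g = \<psi> g"
proof -
  interpret \<phi>: group_hom G P \<phi>
    using assms by (simp add: group_hom_def group_hom_axioms_def is_group)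
  interpret \<psi>: group_hom G P \<psi>
    using assms by (simp add: group_hom_def group_hom_axioms_def is_group)
  show ?thesis
    using assms(6)
  proof induction
    case (eng h1 h2)
    then show ?case using generate_in_carrier[OF assms(4)] by simp
  qed (use assms(4,5) in auto)
qed

text \<open>Homomorphisms that cut out different subsets of \<open>S\<close> must differ on the
  generating set \<open>U\<close>, hence \<open>2 ^ card S \<le> 2 ^ card U\<close>.\<close>

lemma (in group) card_le_if_separated:
  assumes gen: "U \<subseteq> carrier G" "generate G U = carrier G" "finite U"
    and S: "S \<subseteq> carrier G"
    and sep: "\<And>A. A \<subseteq> S \<Longrightarrow> \<exists>\<psi>\<in>hom G bool_group. \<forall>s\<in>S. \<psi> s \<longleftrightarrow> s \<in> A"
  shows "finite S \<and> card S \<le> card U"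
proof -
  obtain \<Psi> where \<Psi>: "\<And>A. A \<subseteq> S \<Longrightarrow> \<Psi> A \<in> hom G bool_group"
    "\<And>A s. A \<subseteq> S \<Longrightarrow> s \<in> S \<Longrightarrow> \<Psi> A s \<longleftrightarrow> s \<in> A"
    using sep by metis
  define \<theta> where "\<theta> A = {x \<in> U. \<Psi> A x}" for A
  have "inj_on \<theta> (Pow S)"
  proof (rule inj_onI)
    fix A A' assume A: "A \<in> Pow S" "A' \<in> Pow S" "\<theta> A = \<theta> A'"
    have "\<Psi> A s = \<Psi> A' s" if "s \<in> S" for s
      by (rule hom_eq_on_generate[OF group_bool_group, where U = U])
        (use A \<Psi>(1) gen S that in \<open>auto simp: \<theta>_def\<close>)
    then show "A = A'" using A \<Psi>(2) by blast
  qed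
  moreover have "\<theta> ` Pow S \<subseteq> Pow U" by (auto simp: \<theta>_def)
  moreover have "finite (Pow U)" using gen(3) by simp
  ultimately have "finite (Pow S)" "card (Pow S) \<le> card (Pow U)"
    by (rule inj_on_finite, rule card_inj_on_le)
  then show ?thesis by (simp add: card_Pow gen(3) finite_Pow_iff)
qed

lemma (in free_group) ex_separating_hom:
  "\<exists>\<psi>\<in>hom F bool_group. \<forall>b\<in>B. \<psi> b \<longleftrightarrow> b \<in> A"
  using universal[OF group_bool_group, of "\<lambda>b. b \<in> A"] by simp

lemma (in group) free_basis_card_le:
  assumes "free_basis G S" "U \<subseteq> carrier G" "generate G U = carrier G" "finite U"
  shows "finite S \<and> card S \<le> card U"
proof -
  interpret free_group G S by (rule free_groupI[OF is_group assms(1)])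
  show ?thesis
    by (rule card_le_if_separated[OF assms(2-4) basis_subset]) (rule ex_separating_hom)
qed

section \<open>Extending homomorphisms along embeddings of coset graphs\<close>

text \<open>
  \<open>\<phi>\<close> is the restriction of a function \<open>\<rho>\<close> on \<open>F\<close>, whose coboundary is a labelling of the coset
  graph of \<open>G\<close>.  The hypothesis on \<open>D\<close> says that the part of this graph spanned by \<open>D\<close> embeds into the
  coset graph of \<open>K\<close>; extending the labels by zero to the rest of the coset graph of \<open>K\<close> yields \<open>\<psi>\<close>.
\<close>

lemma (in free_group) extend_hom:
  assumes K: "subgroup K F" and G: "subgroup G F" "G \<subseteq> K" and D: "D \<subseteq> carrier F"
    and embed: "\<And>d d'. \<lbrakk>d \<in> D; d' \<in> D; d' \<otimes> inv d \<in> K\<rbrakk> \<Longrightarrow> d' \<otimes> inv d \<in> G"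
    and \<phi>: "\<phi> \<in> hom (F\<lparr>carrier := G\<rparr>) bool_group"
  shows "\<exists>\<psi>\<in>hom (F\<lparr>carrier := K\<rparr>) bool_group.
    \<forall>w. set w \<subseteq> UNIV \<times> B \<and> (\<forall>n. word_val F (take n w) \<in> D) \<and> word_val F w \<in> G \<longrightarrow>
      \<psi> (word_val F w) = \<phi> (word_val F w)"
proof -
  obtain t where t: "\<And>a. a \<in> carrier F \<Longrightarrow> t a \<in> carrier F" "\<And>a. a \<in> carrier F \<Longrightarrow> t a \<otimes> inv a \<in> G"
    and t_inv: "\<And>k a. k \<in> G \<Longrightarrow> a \<in> carrier F \<Longrightarrow> t (k \<otimes> a) = t a"
    and t_one: "t \<one> = \<one>"
    using schreier_transversal[OF G(1)] by metis
  have GF: "g \<in> carrier F" if "g \<in> G" for g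
    using G(1) that by (rule subgroup.mem_carrier)
  have KF: "k \<in> carrier F" if "k \<in> K" for k
    using K that by (rule subgroup.mem_carrier)
  have \<phi>_mult: "\<phi> (x \<otimes> y) \<longleftrightarrow> \<phi> x \<noteq> \<phi> y" if "x \<in> G" "y \<in> G" for x y
    using \<phi> that by (auto simp: hom_def)
  \<comment> \<open>Each \<open>a\<close> is an element of \<open>G\<close> times its representative
    \<open>t a\<close>, and \<open>\<rho>\<close> evaluates \<open>\<phi>\<close> on the first
    factor; translation by \<open>g\<close> in \<open>G\<close> thus shifts \<open>\<rho>\<close> by
    the constant \<open>\<phi> g\<close>.\<close>
  define \<rho> where "\<rho> a = \<phi> (a \<otimes> inv (t a))" for a
  have \<rho>_G: "\<rho> g = \<phi> g" if "g \<in> G" for g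
    using t_inv[OF that one_closed] GF[OF that] by (simp add: \<rho>_def t_one)
  have \<rho>_mult: "\<rho> (g \<otimes> a) \<longleftrightarrow> \<phi> g \<noteq> \<rho> a" if "g \<in> G" "a \<in> carrier F" for g a
  proof -
    have "a \<otimes> inv (t a) = inv (t a \<otimes> inv a)" using t that by (simp add: inv_mult_group)
    then have "a \<otimes> inv (t a) \<in> G"
      using subgroup.m_inv_closed[OF G(1) t(2)[OF that(2)]] by simp
    then show ?thesis
      using that GF t \<phi>_mult[of g "a \<otimes> inv (t a)"] by (simp add: \<rho>_def t_inv m_assoc)
  qed
  \<comment> \<open>The coboundary of \<open>\<rho>\<close>, taken at a point of \<open>D\<close> in
    the coset \<open>K a\<close>; the default is \<open>False\<close> where that coset misses
    \<open>D\<close>.\<close>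
  define c where "c a b \<longleftrightarrow> (\<exists>d\<in>D. d \<otimes> inv a \<in> K \<and> \<rho> d \<noteq> \<rho> (d \<otimes> b))" for a b
  interpret labelled_free_group F B bool_group c
    by (simp add: labelled_free_group_def labelled_free_group_axioms_def free_group_axioms
        group_bool_group)
  have c_inv: "c (k \<otimes> a) b = c a b" if k: "k \<in> K" and a: "a \<in> carrier F" for k a b
  proof -
    have "d \<otimes> inv (k \<otimes> a) \<in> K \<longleftrightarrow> d \<otimes> inv a \<in> K" if "d \<in> D" for d
    proof -
      have d: "d \<in> carrier F" using that D by blast
      have "d \<otimes> inv (k \<otimes> a) = (d \<otimes> inv a) \<otimes> inv k" "d \<otimes> inv a = d \<otimes> inv (k \<otimes> a) \<otimes> k"
        using d a KF[OF k] by (simp_all add: inv_mult_group m_assoc)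
      then show ?thesis
        using subgroup.m_closed[OF K] subgroup.m_inv_closed[OF K] k by metis
    qed
    then show ?thesis by (auto simp: c_def)
  qed
  \<comment> \<open>Points of \<open>D\<close> in one coset of \<open>K\<close> differ by an element
    of \<open>G\<close>, which shifts both values of \<open>\<rho>\<close> by the same constant, so
    the witness in \<open>c\<close> does not matter.\<close>
  have c_D: "c d b \<longleftrightarrow> \<rho> d \<noteq> \<rho> (d \<otimes> b)" if d: "d \<in> D" and b: "b \<in> B" for d b
  proof -
    have dF: "d \<in> carrier F" "b \<in> carrier F" using d b D basis_closed by auto
    have "\<rho> d' \<noteq> \<rho> (d' \<otimes> b) \<longleftrightarrow> \<rho> d \<noteq> \<rho> (d \<otimes> b)" if d': "d' \<in> D" "d' \<otimes> inv d \<in> K" for d'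
    proof -
      have g: "d' \<otimes> inv d \<in> G" using embed d d' by blast
      have "d' \<in> carrier F" using d' D by blast
      then have "d' = (d' \<otimes> inv d) \<otimes> d" "d' \<otimes> b = (d' \<otimes> inv d) \<otimes> (d \<otimes> b)"
        using dF by (simp_all add: m_assoc)
      then have "\<rho> d' \<longleftrightarrow> \<phi> (d' \<otimes> inv d) \<noteq> \<rho> d" "\<rho> (d' \<otimes> b) \<longleftrightarrow> \<phi> (d' \<otimes> inv d) \<noteq> \<rho> (d \<otimes> b)"
        using \<rho>_mult[OF g dF(1)] \<rho>_mult[OF g, of "d \<otimes> b"] dF by auto
      then show ?thesis by blast
    qed
    moreover have "d \<otimes> inv d \<in> K" using dF K by (simp add: subgroup.one_closed)
    ultimately show ?thesis using d unfolding c_def by blast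
  qed
  have agree: "potential (word_val F w) = \<rho> (word_val F w)"
    if "set w \<subseteq> UNIV \<times> B" "\<And>n. word_val F (take n w) \<in> D" for w
    using that
  proof (induction w rule: rev_induct)
    case Nil
    have "\<phi> \<one> \<longleftrightarrow> False" using \<phi>_mult[of \<one> \<one>] subgroup.one_closed[OF G(1)] by simp
    then show ?case using \<rho>_G[of \<one>] subgroup.one_closed[OF G(1)] by (simp add: potential_one)
  next
    case (snoc u w)
    obtain e b where u: "u = (e, b)" by (cases u)
    have "set w \<subseteq> UNIV \<times> B" "b \<in> B" using snoc.prems(1) u by auto
    then have w: "word_val F w \<in> carrier F" "b \<in> B" "b \<in> carrier F"
      by (auto simp: val_closed basis_closed)
    have wD: "word_val F (take n w) \<in> D" for n
      using snoc.prems(2)[of "min n (length w)"] by (cases "n \<le> length w") auto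
    have IH: "potential (word_val F w) = \<rho> (word_val F w)"
      by (rule snoc.IH) (use snoc.prems wD in auto)
    have wu: "word_val F (w @ [u]) = word_val F w \<otimes> letter_val F u"
      using snoc.prems(1) w by (simp add: val_append letter_closed u)
    have in_D: "word_val F w \<in> D" "word_val F w \<otimes> letter_val F u \<in> D"
      using wD[of "length w"] snoc.prems(2)[of "length (w @ [u])"] wu by auto
    show ?case
    proof (cases e)
      case True
      then show ?thesis using potential_step[OF w(1,2)] c_D[OF in_D(1) w(2)] IH wu by (auto simp: u)
    next
      case False
      \<comment> \<open>Here the label is read at \<open>a\<close>, the endpoint of the extended
        word; so the full word, and not only its proper prefixes, must end in
        \<open>D\<close>.\<close>
      define a where "a = word_val F w \<otimes> inv b"
      have a: "a \<in> carrier F" "a \<otimes> b = word_val F w" using w by (auto simp: a_def m_assoc)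
      have "a \<in> D" "word_val F (w @ [u]) = a" using in_D False wu by (auto simp: u a_def)
      then show ?thesis using potential_step[OF a(1) w(2)] c_D[OF _ w(2), of a] IH a by auto
    qed
  qed
  show ?thesis
  proof (intro bexI[of _ potential] allI impI)
    show "potential \<in> hom (F\<lparr>carrier := K\<rparr>) bool_group"
      using potential_mult[OF K c_inv] KF by (auto simp: hom_def)
  qed (use agree \<rho>_G in auto)
qed

text \<open>This is \<open>extend_hom\<close> with \<open>D = L\<close>: elements of
  \<open>L\<close> in one coset of \<open>K\<close> differ by an element of
  \<open>L \<inter> K\<close>. In the basis \<open>Y \<union> Z\<close> of \<open>F\<close>, words
  over \<open>Y\<close> never leave \<open>L\<close>, so the extension keeps the values on
  \<open>U\<close>.\<close>

lemma (in free_group) free_factor_inter_card: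
  assumes L: "free_factor L F" and K: "subgroup K F"
    and U: "free_basis (F\<lparr>carrier := L \<inter> K\<rparr>) U" and V: "free_basis (F\<lparr>carrier := K\<rparr>) V" "finite V"
  shows "finite U \<and> card U \<le> card V"
proof -
  obtain M where fp: "is_free_product F L M" using L by (auto simp: free_factor_def)
  then have sub: "subgroup L F" "subgroup M F" by (auto simp: is_free_product_def)
  have LK: "subgroup (L \<inter> K) F" using subgroups_Inter_pair[OF sub(1) K] .
  obtain Y Z where Y: "free_basis (F\<lparr>carrier := L\<rparr>) Y" and Z: "free_basis (F\<lparr>carrier := M\<rparr>) Z"
    using nielsen_schreier sub by blast
  interpret YZ: free_group F "Y \<union> Z"
    by (rule free_groupI[OF is_group free_product_basis(1)[OF fp Y Z]])
  interpret K: free_group "F\<lparr>carrier := K\<rparr>" V by (rule free_groupI[OF subgroup_imp_group[OF K] V(1)])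
  interpret U: free_group "F\<lparr>carrier := L \<inter> K\<rparr>" U by (rule free_groupI[OF subgroup_imp_group[OF LK] U])
  interpret Y: free_group "F\<lparr>carrier := L\<rparr>" Y by (rule free_groupI[OF subgroup_imp_group[OF sub(1)] Y])
  have YL: "Y \<subseteq> L" using Y.basis_subset by simp
  show ?thesis
  proof (rule K.card_le_if_separated[OF K.basis_subset K.generate_basis V(2)])
    show "U \<subseteq> carrier (F\<lparr>carrier := K\<rparr>)" using U.basis_subset by simp
    fix A assume "A \<subseteq> U"
    obtain \<phi> where \<phi>: "\<phi> \<in> hom (F\<lparr>carrier := L \<inter> K\<rparr>) bool_group" "\<And>x. x \<in> U \<Longrightarrow> \<phi> x \<longleftrightarrow> x \<in> A"
      using U.ex_separating_hom[of A] by blast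
    have "d' \<otimes> inv d \<in> L \<inter> K" if "d \<in> L" "d' \<in> L" "d' \<otimes> inv d \<in> K" for d d'
      using that sub(1) by (simp add: subgroup.m_closed subgroup.m_inv_closed)
    from YZ.extend_hom[OF K LK _ subgroup.subset[OF sub(1)] this \<phi>(1)]
    obtain \<psi> where \<psi>: "\<psi> \<in> hom (F\<lparr>carrier := K\<rparr>) bool_group"
      "\<And>w. \<lbrakk>set w \<subseteq> UNIV \<times> (Y \<union> Z); \<forall>n. word_val F (take n w) \<in> L; word_val F w \<in> L \<inter> K\<rbrakk>
        \<Longrightarrow> \<psi> (word_val F w) = \<phi> (word_val F w)" by auto
    have "\<psi> x = \<phi> x" if "x \<in> U" for x
    proof -
      have x: "x \<in> L \<inter> K" using that U.basis_subset by auto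
      then obtain w where w: "set w \<subseteq> UNIV \<times> Y" "word_val (F\<lparr>carrier := L\<rparr>) w = x"
        using Y.ex_word[of x] by auto
      have val: "word_val (F\<lparr>carrier := L\<rparr>) v = word_val F v" if "set v \<subseteq> UNIV \<times> Y" for v
        using that YL by (intro word_val_restrict[OF sub(1)]) auto
      have "word_val F (take n w) \<in> L" for n
        using Y.val_closed[of "take n w"] val[of "take n w"] w(1) set_take_subset[of n w] by auto
      then show ?thesis using \<psi>(2)[of w] w x val[OF w(1)] by auto
    qed
    then show "\<exists>\<psi>\<in>hom (F\<lparr>carrier := K\<rparr>) bool_group. \<forall>s\<in>U. \<psi> s \<longleftrightarrow> s \<in> A"
      using \<psi>(1) \<phi>(2) by blast
  qed
qed

subsection \<open>Inert and compressed subgroups\<close>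

text \<open>Every countable set embeds into any infinite one, so only a finite \<open>A'\<close>
  calls for counting.\<close>

lemma card_of_ordLeq_if_countable:
  assumes "countable A" and "finite A' \<Longrightarrow> finite A \<and> card A \<le> card A'"
  shows "|A| \<le>o |A'|"
proof (cases "finite A'")
  case True
  then show ?thesis
    using assms(2) inj_on_iff_card_le[of A A'] by (simp flip: card_of_ordLeq)
next
  case False
  have "\<exists>f::_ \<Rightarrow> nat. inj_on f A \<and> f ` A \<subseteq> UNIV" using assms(1) by (auto simp: countable_def)
  then have "|A| \<le>o |UNIV :: nat set|" using card_of_ordLeq by blast
  then show ?thesis
    using False infinite_iff_card_of_nat ordLeq_transitive by blast
qed

lemma card_le_of_ordLeq:
  assumes "|A| \<le>o |A'|" "finite A'"
  shows "finite A" "card A \<le> card A'"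
  using assms card_of_ordLeq[of A A'] by (auto intro: inj_on_finite card_inj_on_le)

text \<open>The factor \<open>carrier F\<close> makes the empty family yield the whole group, since
  \<open>\<Inter> {}\<close> is the whole type.\<close>

lemma subgroup_Int_Inter:
  assumes "group F" "\<And>H. H \<in> Hs \<Longrightarrow> subgroup H F"
  shows "subgroup (carrier F \<inter> \<Inter> Hs) F"
proof -
  interpret group F by fact
  show ?thesis
    using assms(2) by unfold_locales
      (auto intro: subgroup.m_closed subgroup.one_closed subgroup.m_inv_closed)
qed

locale fg_free_group = free_group +
  assumes finite_basis: "finite B"
begin

lemma countable_carrier: "countable (carrier F)"
proof -
  have "carrier F \<subseteq> word_val F ` lists (UNIV \<times> B)"
    using ex_word by (metis image_eqI in_lists_conv_set subsetI subset_code(1))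
  then show ?thesis
    using finite_basis by (meson countable_finite countable_SIGMA countable_image countable_lists countable_subset finite)
qed

text \<open>The existence of bases for subgroups guarantees that the choice in \<open>rk\<close>
  picks one.\<close>

lemma ex_rk_basis:
  assumes "subgroup K F"
  obtains Y where "free_group (F\<lparr>carrier := K\<rparr>) Y" "rk (F\<lparr>carrier := K\<rparr>) = |Y|"
    "Y \<subseteq> K" "generate F Y = K" "countable Y"
proof -
  define Y where "Y = (SOME Y. free_basis (F\<lparr>carrier := K\<rparr>) Y)"
  have "free_basis (F\<lparr>carrier := K\<rparr>) Y"
    unfolding Y_def using nielsen_schreier[OF assms] by (rule someI_ex)
  then have Y: "free_group (F\<lparr>carrier := K\<rparr>) Y"
    by (rule free_groupI[OF subgroup_imp_group[OF assms]])
  interpret Y: free_group "F\<lparr>carrier := K\<rparr>" Y by (rule Y)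
  have YK: "Y \<subseteq> K" using Y.basis_subset by simp
  show thesis
  proof
    show "rk (F\<lparr>carrier := K\<rparr>) = |Y|" by (simp add: rk_def Y_def)
    show "generate F Y = K"
      using generate_consistent[OF YK assms] Y.generate_basis by simp
    show "countable Y"
      by (rule countable_subset[OF order_trans[OF YK subgroup.subset[OF assms]] countable_carrier])
  qed (use Y YK in auto)
qed

section \<open>Free factors of inert and compressed subgroups\<close>

text \<open>\<open>H\<close> itself serves as the ambient free group in
  \<open>free_factor_inter_card\<close>.\<close>

lemma rk_free_factor_inter_le:
  assumes H: "subgroup H F" and L: "free_factor L (F\<lparr>carrier := H\<rparr>)"
    and K: "subgroup K F" "K \<subseteq> H"
  shows "rk (F\<lparr>carrier := L \<inter> K\<rparr>) \<le>o rk (F\<lparr>carrier := K\<rparr>)"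
proof -
  have L': "subgroup L F" "L \<subseteq> H"
    using L subsubgroup_imp_group_iff[OF H] by (auto simp: free_factor_def is_free_product_def)
  obtain Z where Z: "free_basis (F\<lparr>carrier := H\<rparr>) Z" using nielsen_schreier[OF H] by blast
  interpret H: free_group "F\<lparr>carrier := H\<rparr>" Z by (rule free_groupI[OF subgroup_imp_group[OF H] Z])
  obtain U where U: "free_group (F\<lparr>carrier := L \<inter> K\<rparr>) U" "rk (F\<lparr>carrier := L \<inter> K\<rparr>) = |U|" "countable U"
    using ex_rk_basis[OF subgroups_Inter_pair[OF L'(1) K(1)]] by metis
  obtain V where V: "free_group (F\<lparr>carrier := K\<rparr>) V" "rk (F\<lparr>carrier := K\<rparr>) = |V|"
    using ex_rk_basis[OF K(1)] by metis
  have "finite U \<and> card U \<le> card V" if "finite V"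
    by (rule H.free_factor_inter_card[OF L, of K])
      (use U V K that subsubgroup_imp_group_iff[OF H] in \<open>auto simp: free_group.basis\<close>)
  then show ?thesis unfolding U(2) V(2) by (rule card_of_ordLeq_if_countable[OF U(3)])
qed

text \<open>As \<open>L \<subseteq> H\<close>, intersecting \<open>K\<close> with \<open>L\<close>
  amounts to intersecting first with \<open>H\<close> and then with its free factor
  \<open>L\<close>; neither step raises the rank.\<close>

lemma inert_free_factor:
  assumes "inert F H" and L: "free_factor L (F\<lparr>carrier := H\<rparr>)"
  shows "inert F L"
proof -
  have H: "subgroup H F" "\<And>K. subgroup K F \<Longrightarrow> rk (F\<lparr>carrier := H \<inter> K\<rparr>) \<le>o rk (F\<lparr>carrier := K\<rparr>)"
    using assms(1) by (auto simp: inert_def)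
  have L': "subgroup L F" "L \<subseteq> H"
    using L subsubgroup_imp_group_iff[OF H(1)] by (auto simp: free_factor_def is_free_product_def)
  have "rk (F\<lparr>carrier := L \<inter> K\<rparr>) \<le>o rk (F\<lparr>carrier := K\<rparr>)" if "subgroup K F" for K
  proof -
    have "rk (F\<lparr>carrier := L \<inter> (H \<inter> K)\<rparr>) \<le>o rk (F\<lparr>carrier := H \<inter> K\<rparr>)"
      using rk_free_factor_inter_le[OF H(1) L subgroups_Inter_pair[OF H(1) that]] by simp
    moreover have "L \<inter> (H \<inter> K) = L \<inter> K" using L'(2) by blast
    ultimately show ?thesis using ordLeq_transitive[OF _ H(2)[OF that]] by simp
  qed
  then show ?thesis using L'(1) by (simp add: inert_def)
qed

text \<open>In the inequality between sums of ranks, the rank of the complement \<open>M\<close> can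
  be cancelled because it is finite: compressedness, applied to \<open>F\<close> itself, bounds the
  rank of \<open>H\<close> by that of \<open>F\<close>.\<close>

lemma compressed_free_factor:
  assumes "compressed F H" and L: "free_factor L (F\<lparr>carrier := H\<rparr>)"
  shows "compressed F L"
proof -
  have H: "subgroup H F"
    "\<And>K. subgroup K F \<Longrightarrow> H \<subseteq> K \<Longrightarrow> rk (F\<lparr>carrier := H\<rparr>) \<le>o rk (F\<lparr>carrier := K\<rparr>)"
    using assms(1) by (auto simp: compressed_def)
  obtain M where fp: "is_free_product (F\<lparr>carrier := H\<rparr>) L M" using L by (auto simp: free_factor_def)
  then have LM: "subgroup L F" "subgroup M F" "L \<subseteq> H" "M \<subseteq> H"
    using subsubgroup_imp_group_iff[OF H(1)] by (auto simp: is_free_product_def)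
  interpret H: group "F\<lparr>carrier := H\<rparr>" by (rule subgroup_imp_group[OF H(1)])
  obtain Y where Y: "free_group (F\<lparr>carrier := L\<rparr>) Y" "rk (F\<lparr>carrier := L\<rparr>) = |Y|" "Y \<subseteq> L"
    "countable Y" using ex_rk_basis[OF LM(1)] by metis
  obtain Z where Z: "free_group (F\<lparr>carrier := M\<rparr>) Z" "Z \<subseteq> M" "generate F Z = M"
    using ex_rk_basis[OF LM(2)] by metis
  have YZ: "free_basis (F\<lparr>carrier := H\<rparr>) (Y \<union> Z)" "Y \<inter> Z = {}"
    using H.free_product_basis[OF fp, of Y Z] Y(1) Z(1) by (auto simp: free_group.basis)
  obtain U where U: "free_group (F\<lparr>carrier := H\<rparr>) U" "rk (F\<lparr>carrier := H\<rparr>) = |U|" "U \<subseteq> H"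
    using ex_rk_basis[OF H(1)] by metis
  interpret U: free_group "F\<lparr>carrier := H\<rparr>" U by (rule U(1))
  obtain T where T: "free_group (F\<lparr>carrier := carrier F\<rparr>) T" "rk (F\<lparr>carrier := carrier F\<rparr>) = |T|"
    using ex_rk_basis[OF subgroup_self] by metis
  have "finite T"
    using free_basis_card_le[OF _ basis_subset generate_basis finite_basis] free_group.basis[OF T(1)]
    by simp
  moreover have "|U| \<le>o |T|"
    using H(2)[OF subgroup_self subgroup.subset[OF H(1)]] U(2) T(2) by simp
  ultimately have "finite U" by (rule card_le_of_ordLeq[rotated])
  then have fin: "finite (Y \<union> Z)" "card (Y \<union> Z) \<le> card U"
    using H.free_basis_card_le[OF YZ(1) U.basis_subset U.generate_basis] by auto
  have "rk (F\<lparr>carrier := L\<rparr>) \<le>o rk (F\<lparr>carrier := K\<rparr>)" if K: "subgroup K F" "L \<subseteq> K" for K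
  proof -
    obtain V where V: "rk (F\<lparr>carrier := K\<rparr>) = |V|" "V \<subseteq> K" "generate F V = K"
      using ex_rk_basis[OF K(1)] by metis
    have "finite Y \<and> card Y \<le> card V" if "finite V"
    proof -
      \<comment> \<open>The join of \<open>K\<close> and \<open>M\<close>; it contains
        \<open>H\<close> because \<open>Y \<subseteq> K\<close> and
        \<open>Z \<subseteq> M\<close>.\<close>
      define N where "N = generate F (V \<union> Z)"
      have VZ: "V \<union> Z \<subseteq> carrier F"
        using V(2) Z(2) subgroup.subset[OF K(1)] subgroup.subset[OF LM(2)] by blast
      have N: "subgroup N F" unfolding N_def by (rule generate_is_subgroup[OF VZ])
      have KM: "K \<subseteq> N" "M \<subseteq> N"
        unfolding N_def using mono_generate[of V "V \<union> Z"] mono_generate[of Z "V \<union> Z"] V(3) Z(3) by auto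
      interpret N: group "F\<lparr>carrier := N\<rparr>" by (rule subgroup_imp_group[OF N])
      have VZN: "V \<union> Z \<subseteq> N" by (auto simp: N_def intro: generate.incl)
      have "Y \<union> Z \<subseteq> N" using Y(3) Z(2) K(2) KM by blast
      moreover have "generate F (Y \<union> Z) = H"
      proof -
        interpret YZ: free_group "F\<lparr>carrier := H\<rparr>" "Y \<union> Z"
          by (rule free_groupI[OF H.is_group YZ(1)])
        show ?thesis
          using generate_consistent[OF _ H(1), of "Y \<union> Z"] YZ.generate_basis YZ.basis_subset by simp
      qed
      ultimately have "H \<subseteq> N" using generate_subgroup_incl[OF _ N] by blast
      obtain W where W: "free_group (F\<lparr>carrier := N\<rparr>) W" "rk (F\<lparr>carrier := N\<rparr>) = |W|"
        using ex_rk_basis[OF N] by metis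
      have genN: "generate (F\<lparr>carrier := N\<rparr>) (V \<union> Z) = N"
        using generate_consistent[OF VZN N] by (simp add: N_def)
      have "finite W \<and> card W \<le> card (V \<union> Z)"
        by (rule N.free_basis_card_le)
          (use W(1) VZN genN that fin in \<open>auto simp: free_group.basis\<close>)
      moreover have "|U| \<le>o |W|" using H(2)[OF N \<open>H \<subseteq> N\<close>] U(2) W(2) by simp
      ultimately have "card U \<le> card (V \<union> Z)" using card_le_of_ordLeq(2) by fastforce
      also have "\<dots> \<le> card V + card Z" by (rule card_Un_le)
      finally have "card (Y \<union> Z) \<le> card V + card Z" using fin(2) by linarith
      then show ?thesis using fin(1) YZ(2) by (simp add: card_Un_disjoint)
    qed
    then show ?thesis unfolding Y(2) V(1) by (rule card_of_ordLeq_if_countable[OF Y(4)])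
  qed
  then show ?thesis using LM(1) by (simp add: compressed_def)
qed

section \<open>Intersections of inert subgroups and the inert closure\<close>

text \<open>One inert subgroup at a time: each is applied to the intersection of \<open>K\<close>
  with those treated before.\<close>

lemma inert_finite_Inter:
  assumes "finite Hs" "\<And>H. H \<in> Hs \<Longrightarrow> inert F H" "subgroup K F"
  shows "rk (F\<lparr>carrier := \<Inter> Hs \<inter> K\<rparr>) \<le>o rk (F\<lparr>carrier := K\<rparr>)"
  using assms(1,2)
proof (induction Hs rule: finite_induct)
  case empty
  then show ?case by (simp add: rk_def card_of_ordLeq_if_countable card_of_refl ordLeq_refl)
next
  case (insert H Hs)
  have "subgroup (carrier F \<inter> \<Inter> Hs) F"
    using insert.prems by (intro subgroup_Int_Inter is_group) (auto simp: inert_def)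
  then have "subgroup (carrier F \<inter> \<Inter> Hs \<inter> K) F" using assms(3) by (rule subgroups_Inter_pair)
  moreover have "carrier F \<inter> \<Inter> Hs \<inter> K = \<Inter> Hs \<inter> K"
    using subgroup.subset[OF assms(3)] by blast
  ultimately have "subgroup (\<Inter> Hs \<inter> K) F" by simp
  then have "rk (F\<lparr>carrier := H \<inter> (\<Inter> Hs \<inter> K)\<rparr>) \<le>o rk (F\<lparr>carrier := \<Inter> Hs \<inter> K\<rparr>)"
    using insert.prems by (simp add: inert_def)
  moreover have "rk (F\<lparr>carrier := \<Inter> Hs \<inter> K\<rparr>) \<le>o rk (F\<lparr>carrier := K\<rparr>)"
    using insert by simp
  ultimately show ?case by (auto simp: Int_assoc intro: ordLeq_transitive)
qed

text \<open>
  If \<open>C \<inter> K\<close> had larger rank than \<open>K\<close>, this would be visible on a finite set \<open>S\<close> of basis elements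
  of \<open>C \<inter> K\<close>.  The prefixes of the words for \<open>S\<close> form a finite part of the coset graph of \<open>C \<inter> K\<close>,
  which already embeds into the coset graph of \<open>\<Inter> Hs' \<inter> K\<close> for a finite subfamily \<open>Hs'\<close>.
\<close>

lemma inert_Inter:
  assumes inert: "\<And>H. H \<in> Hs \<Longrightarrow> inert F H"
  shows "inert F (carrier F \<inter> \<Inter> Hs)"
proof -
  define C where "C = carrier F \<inter> \<Inter> Hs"
  have C: "subgroup C F"
    unfolding C_def using inert by (intro subgroup_Int_Inter is_group) (auto simp: inert_def)
  have "rk (F\<lparr>carrier := C \<inter> K\<rparr>) \<le>o rk (F\<lparr>carrier := K\<rparr>)" if K: "subgroup K F" for K
  proof -
    have CK: "subgroup (C \<inter> K) F" by (rule subgroups_Inter_pair[OF C K])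
    obtain U where U: "free_group (F\<lparr>carrier := C \<inter> K\<rparr>) U" "rk (F\<lparr>carrier := C \<inter> K\<rparr>) = |U|"
      "U \<subseteq> C \<inter> K" "countable U" using ex_rk_basis[OF CK] by metis
    interpret U: free_group "F\<lparr>carrier := C \<inter> K\<rparr>" U by (rule U(1))
    obtain V where V: "rk (F\<lparr>carrier := K\<rparr>) = |V|" using ex_rk_basis[OF K] by metis
    \<comment> \<open>Finite parts of \<open>U\<close> suffice, since an infinite \<open>U\<close>
      would contain one of size \<open>Suc (card V)\<close>.\<close>
    have bound: "card S \<le> card V" if V_fin: "finite V" and S: "finite S" "S \<subseteq> U" for S
    proof -
      have SF: "S \<subseteq> carrier F" using S(2) U(3) by (auto simp: C_def)
      then have "\<forall>s\<in>S. \<exists>w. set w \<subseteq> UNIV \<times> B \<and> word_val F w = s" using ex_word by (metis subsetD)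
      then obtain ws where ws: "\<And>s. s \<in> S \<Longrightarrow> set (ws s) \<subseteq> UNIV \<times> B"
        "\<And>s. s \<in> S \<Longrightarrow> word_val F (ws s) = s" by metis
      define D where "D = (\<Union>s\<in>S. (\<lambda>n. word_val F (take n (ws s))) ` {..length (ws s)})"
      have prefix_D: "word_val F (take n (ws s)) \<in> D" if "s \<in> S" for s n
      proof -
        have "take n (ws s) = take (min n (length (ws s))) (ws s)"
          by (cases "n \<le> length (ws s)") auto
        then show ?thesis using that unfolding D_def
          by (intro UN_I[of s] image_eqI[of _ _ "min n (length (ws s))"]) auto
      qed
      have D: "finite D" "D \<subseteq> carrier F"
        using S(1) ws(1) by (auto simp: D_def intro!: val_closed dest!: in_set_takeD)
      \<comment> \<open>Only finitely many quotients of points of \<open>D\<close> lie outside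
        \<open>C\<close>; choosing for each a member of the family that omits it gives the finite
        subfamily.\<close>
      define Q where "Q = (\<lambda>(d, d'). d' \<otimes> inv d) ` (D \<times> D) - C"
      have "\<exists>H\<in>Hs. q \<notin> H" if "q \<in> Q" for q
        using that D(2) by (auto simp: Q_def C_def subset_iff)
      then obtain h where h: "\<And>q. q \<in> Q \<Longrightarrow> h q \<in> Hs \<and> q \<notin> h q" by metis
      define N where "N = \<Inter> (h ` Q) \<inter> K"
      have sub: "subgroup N F"
      proof -
        have "subgroup (carrier F \<inter> \<Inter> (h ` Q)) F"
          using h inert by (intro subgroup_Int_Inter is_group) (auto simp: inert_def)
        then have "subgroup (carrier F \<inter> \<Inter> (h ` Q) \<inter> K) F" using K by (rule subgroups_Inter_pair)
        moreover have "carrier F \<inter> \<Inter> (h ` Q) \<inter> K = N"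
          using subgroup.subset[OF K] by (auto simp: N_def)
        ultimately show ?thesis by simp
      qed
      have "C \<inter> K \<subseteq> N" using h by (auto simp: C_def N_def)
      have embed: "d' \<otimes> inv d \<in> C \<inter> K" if "d \<in> D" "d' \<in> D" "d' \<otimes> inv d \<in> N" for d d'
      proof (rule ccontr)
        assume "d' \<otimes> inv d \<notin> C \<inter> K"
        then have "d' \<otimes> inv d \<in> Q" using that by (auto simp: Q_def N_def)
        then show False using that(3) h by (auto simp: N_def)
      qed
      obtain W where W: "free_group (F\<lparr>carrier := N\<rparr>) W" "rk (F\<lparr>carrier := N\<rparr>) = |W|"
        using ex_rk_basis[OF sub] by metis
      have "finite (h ` Q)" using D(1) by (simp add: Q_def)
      then have "|W| \<le>o |V|"
        using inert_finite_Inter[OF _ _ K, of "h ` Q"] h inert W(2) V unfolding N_def by auto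
      then have W_fin: "finite W" "card W \<le> card V"
        using card_le_of_ordLeq V_fin by blast+
      interpret W: free_group "F\<lparr>carrier := N\<rparr>" W by (rule W(1))
      have "finite S \<and> card S \<le> card W"
      proof (rule W.card_le_if_separated[OF W.basis_subset W.generate_basis W_fin(1)])
        show "S \<subseteq> carrier (F\<lparr>carrier := N\<rparr>)" using S(2) U(3) \<open>C \<inter> K \<subseteq> N\<close> by auto
        fix A assume "A \<subseteq> S"
        obtain \<phi> where \<phi>: "\<phi> \<in> hom (F\<lparr>carrier := C \<inter> K\<rparr>) bool_group" "\<And>u. u \<in> U \<Longrightarrow> \<phi> u \<longleftrightarrow> u \<in> A"
          using U.ex_separating_hom[of A] by blast
        obtain \<psi> where \<psi>: "\<psi> \<in> hom (F\<lparr>carrier := N\<rparr>) bool_group"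
          "\<And>w. \<lbrakk>set w \<subseteq> UNIV \<times> B; \<forall>n. word_val F (take n w) \<in> D; word_val F w \<in> C \<inter> K\<rbrakk>
            \<Longrightarrow> \<psi> (word_val F w) = \<phi> (word_val F w)"
          using extend_hom[OF sub CK \<open>C \<inter> K \<subseteq> N\<close> D(2) embed \<phi>(1)] by blast
        have "\<psi> s \<longleftrightarrow> s \<in> A" if "s \<in> S" for s
          using \<psi>(2)[OF ws(1)[OF that]] prefix_D[OF that] ws(2)[OF that] \<phi>(2)[of s] that S(2) U(3)
          by auto
        then show "\<exists>\<psi>\<in>hom (F\<lparr>carrier := N\<rparr>) bool_group. \<forall>s\<in>S. \<psi> s \<longleftrightarrow> s \<in> A"
          using \<psi>(1) by blast
      qed
      then show ?thesis using W_fin(2) by linarith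
    qed
    have "finite U \<and> card U \<le> card V" if "finite V"
    proof -
      have "finite U"
      proof (rule ccontr)
        assume "infinite U"
        then obtain S where "finite S" "card S = Suc (card V)" "S \<subseteq> U"
          using infinite_arbitrarily_large by blast
        then show False using bound[OF that, of S] by simp
      qed
      then show ?thesis using bound[OF that, of U] by simp
    qed
    then show ?thesis unfolding U(2) V by (rule card_of_ordLeq_if_countable[OF U(4)])
  qed
  then show ?thesis using C by (simp add: inert_def C_def)
qed

text \<open>A free factor of \<open>C\<close> that contains \<open>H\<close> is again inert, so the
  minimality of \<open>C\<close> forces it to be all of \<open>C\<close>.\<close>

lemma ex_inert_closure:
  assumes H: "subgroup H F"
  shows "\<exists>C. inert_closure F H C \<and> algebraic_extension H (F\<lparr>carrier := C\<rparr>)"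
proof -
  define C where "C = carrier F \<inter> \<Inter> {K. inert F K \<and> H \<subseteq> K}"
  have C: "inert F C" "H \<subseteq> C"
    using subgroup.subset[OF H] unfolding C_def by (auto intro!: inert_Inter)
  have least: "C \<subseteq> K" if "inert F K" "H \<subseteq> K" for K
    using that by (auto simp: C_def)
  have "subgroup C F" using C(1) by (simp add: inert_def)
  then have "subgroup H (F\<lparr>carrier := C\<rparr>)" using H C(2) by (simp add: subsubgroup_imp_group_iff)
  moreover have "x \<in> L" if "x \<in> C" "free_factor L (F\<lparr>carrier := C\<rparr>)" "H \<subseteq> L" for x L
    using least[OF inert_free_factor[OF C(1) that(2)] that(3)] that(1) by blast
  ultimately show ?thesis
    using C least
    by (intro exI[of _ C] conjI) (auto simp: inert_closure_def algebraic_extension_def)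
qed

end

theorem proposition4p7:
  fixes F :: "('a, 'b) monoid_scheme" and B :: "'a set"
  assumes "group F" and "free_basis F B" and "finite B"
  shows "(\<forall>H L. inert F H \<and> free_factor L (F\<lparr>carrier := H\<rparr>) \<longrightarrow> inert F L)
       \<and> (\<forall>H L. compressed F H \<and> free_factor L (F\<lparr>carrier := H\<rparr>) \<longrightarrow> compressed F L)
       \<and> (\<forall>Hs. (\<forall>H\<in>Hs. inert F H) \<longrightarrow> inert F (carrier F \<inter> \<Inter> Hs))
       \<and> (\<forall>H. subgroup H F \<longrightarrow>
            (\<exists>C. inert_closure F H C \<and> algebraic_extension H (F\<lparr>carrier := C\<rparr>)))"
proof -
  interpret fg_free_group F B
    using assms by (simp add: fg_free_group_def fg_free_group_axioms_def free_groupI)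
  show ?thesis
    using inert_free_factor compressed_free_factor inert_Inter ex_inert_closure by blast
qed

end
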